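(* Let $\mu_4$ be the invariant measure for the affine IFS on $\mathbb{R}$ with $R=4$ and $B=\{0,2\}$, and let $\mu_4'$ be the invariant measure for the affine IFS on $\mathbb{R}$ with $R=4$ and $C=\{0,1\}$. Then $|\widehat{\mu_4'}(x)|^2\,dx$ and $\sum_{n\in\mathbb{Z}}|\widehat{\mu_4'}(n)|^2\delta_n$ are Plancherel measures for $\mu_4$. Therefore, $\{|\widehat{\mu_4'}(n)|\,e_n : n\in\mathbb{Z}\}\subset L^2(\mu_4)$ is a Parseval frame. Moreover, if $\{e_{\lambda_n}\}\subset L^2[0,1]$ is a Fourier frame (a frame of exponentials for $L^2[0,1]$), then $\{|\widehat{\mu_4'}(\lambda_n)|\,e_{\lambda_n}\}\subset L^2(\mu_4)$ is a frame for $L^2(\mu_4)$, with the same frame bounds.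
   Context: For an integer $R\ge2$ and a finite set $B\subset\mathbb{Z}$ with $N=\#B$, the affine IFS is $\tau_b(x)=R^{-1}(x+b)$, $b\in B$; its invariant measure is the unique Borel probability measure $\mu$ on $\mathbb{R}$ with $\int f\,d\mu=\frac1N\sum_{b\in B}\int f\circ\tau_b\,d\mu$ for all compactly supported continuous $f$. Notation: $e_t(x)=e^{2\pi i t x}$; $\widehat\mu(t)=\int e^{-2\pi i tx}\,d\mu(x)$; $\widehat{f\,d\mu}(t)=\int f(x)e^{-2\pi i tx}\,d\mu(x)$; $\delta_a$ is the Dirac measure at $a$. A Borel measure $\nu$ on $\mathbb{R}$ is a Plancherel measure for $\mu$ if $\|\widehat{f\,d\mu}\|_{L^2(\nu)}=\|f\|_{L^2(\mu)}$ for every $f\in L^2(\mu)$. A sequence $\{x_n\}$ in a Hilbert space is a frame with bounds $A,B>0$ if $A\|v\|^2\le\sum_n|\langle v,x_n\rangle|^2\le B\|v\|^2$ for all $v$; it is Parseval if $A=B=1$. *)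

theory Defs
  imports "HOL-Probability.Probability"
begin

definition ifs_map :: "int \<Rightarrow> int \<Rightarrow> real \<Rightarrow> real" where
  "ifs_map R b x = (x + of_int b) / of_int R"

definition ifs_invariant_measure :: "int \<Rightarrow> int set \<Rightarrow> real measure \<Rightarrow> bool" where
  "ifs_invariant_measure R B \<mu> \<longleftrightarrow>
     2 \<le> R \<and> finite B \<and> prob_space \<mu> \<and> sets \<mu> = sets borel \<and>
     (\<forall>f :: real \<Rightarrow> complex. continuous_on UNIV f \<and> compact (closure {x. f x \<noteq> 0}) \<longrightarrow>
        (LINT x|\<mu>. f x) = 1 / of_nat (card B) * (\<Sum>b\<in>B. LINT x|\<mu>. f (ifs_map R b x)))"

definition expo :: "real \<Rightarrow> real \<Rightarrow> complex" where
  "expo t x = exp (2 * complex_of_real pi * \<i> * complex_of_real t * complex_of_real x)"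

definition fourier_measure :: "real measure \<Rightarrow> real \<Rightarrow> complex" where
  "fourier_measure \<mu> t = (LINT x|\<mu>. expo (- t) x)"

definition fourier_fun :: "real measure \<Rightarrow> (real \<Rightarrow> complex) \<Rightarrow> real \<Rightarrow> complex" where
  "fourier_fun \<mu> f t = (LINT x|\<mu>. f x * expo (- t) x)"

text \<open>Elements of \<open>L\<^sup>2(M)\<close> are represented by functions, not by almost-everywhere classes; the
  predicates below depend only on the class.\<close>

definition L2 :: "'a measure \<Rightarrow> ('a \<Rightarrow> complex) set" where
  "L2 M = {f. f \<in> borel_measurable M \<and> integrable M (\<lambda>x. (cmod (f x))\<^sup>2)}"

definition L2_norm :: "'a measure \<Rightarrow> ('a \<Rightarrow> complex) \<Rightarrow> real" where
  "L2_norm M f = sqrt (LINT x|M. (cmod (f x))\<^sup>2)"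

definition L2_inner :: "'a measure \<Rightarrow> ('a \<Rightarrow> complex) \<Rightarrow> ('a \<Rightarrow> complex) \<Rightarrow> complex" where
  "L2_inner M f g = (LINT x|M. f x * cnj (g x))"

text \<open>Membership in \<open>L2 \<nu>\<close> is required separately because \<open>L2_norm\<close> of a function that is not
  square integrable is \<open>0\<close>.\<close>

definition plancherel_measure :: "real measure \<Rightarrow> real measure \<Rightarrow> bool" where
  "plancherel_measure \<nu> \<mu> \<longleftrightarrow> sets \<nu> = sets borel \<and>
     (\<forall>f\<in>L2 \<mu>. fourier_fun \<mu> f \<in> L2 \<nu> \<and> L2_norm \<nu> (fourier_fun \<mu> f) = L2_norm \<mu> f)"

text \<open>The summability clause is part of the upper bound: \<open>infsum\<close> of a divergent family is \<open>0\<close>.\<close>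

definition L2_frame :: "'a measure \<Rightarrow> ('i \<Rightarrow> 'a \<Rightarrow> complex) \<Rightarrow> real \<Rightarrow> real \<Rightarrow> bool" where
  "L2_frame M x A B \<longleftrightarrow> 0 < A \<and> 0 < B \<and> range x \<subseteq> L2 M \<and>
     (\<forall>v\<in>L2 M.
        (\<lambda>n. (cmod (L2_inner M v (x n)))\<^sup>2) summable_on UNIV \<and>
        A * (L2_norm M v)\<^sup>2 \<le> (\<Sum>\<^sub>\<infinity>n. (cmod (L2_inner M v (x n)))\<^sup>2) \<and>
        (\<Sum>\<^sub>\<infinity>n. (cmod (L2_inner M v (x n)))\<^sup>2) \<le> B * (L2_norm M v)\<^sup>2)"

definition L2_parseval_frame :: "'a measure \<Rightarrow> ('i \<Rightarrow> 'a \<Rightarrow> complex) \<Rightarrow> bool" where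
  "L2_parseval_frame M x \<longleftrightarrow> L2_frame M x 1 1"

definition sum_measure :: "('i \<Rightarrow> real measure) \<Rightarrow> real measure" where
  "sum_measure M = measure_of UNIV (sets borel) (\<lambda>E. \<integral>\<^sup>+ i. emeasure (M i) E \<partial>count_space UNIV)"

lemma sets_sum_measure [simp]: "sets (sum_measure M) = sets borel"
  unfolding sum_measure_def by (metis sets.sigma_sets_eq sets_measure_of sets.space_closed space_borel)

text \<open>\<open>measure_of\<close> yields the zero measure on set functions that are not measures, so countable
  additivity has to be checked.\<close>

lemma emeasure_sum_measure:
  assumes M: "\<And>i. sets (M i) = sets borel" and E: "E \<in> sets borel"
  shows "emeasure (sum_measure M) E = (\<integral>\<^sup>+ i. emeasure (M i) E \<partial>count_space UNIV)"
proof (rule emeasure_measure_of[OF sum_measure_def])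
  show "sets borel \<subseteq> Pow (UNIV :: real set)" by simp
  show "E \<in> sets (sum_measure M)" using E by simp
  show "positive (sets (sum_measure M)) (\<lambda>E. \<integral>\<^sup>+ i. emeasure (M i) E \<partial>count_space UNIV)"
    by (simp add: positive_def)
  show "countably_additive (sets (sum_measure M)) (\<lambda>E. \<integral>\<^sup>+ i. emeasure (M i) E \<partial>count_space UNIV)"
  proof (rule countably_additiveI)
    fix A :: "nat \<Rightarrow> real set"
    assume A: "range A \<subseteq> sets (sum_measure M)" "disjoint_family A"
    have "(\<Sum>n. \<integral>\<^sup>+ i. emeasure (M i) (A n) \<partial>count_space UNIV)
        = (\<integral>\<^sup>+ i. (\<Sum>n. emeasure (M i) (A n)) \<partial>count_space UNIV)"
      by (rule nn_integral_suminf[symmetric]) simp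
    also have "\<dots> = (\<integral>\<^sup>+ i. emeasure (M i) (\<Union>n. A n) \<partial>count_space UNIV)"
      using A M by (intro nn_integral_cong suminf_emeasure) auto
    finally show "(\<Sum>n. \<integral>\<^sup>+ i. emeasure (M i) (A n) \<partial>count_space UNIV)
        = (\<integral>\<^sup>+ i. emeasure (M i) (\<Union>n. A n) \<partial>count_space UNIV)" .
  qed
qed

end

theory Submission
  imports Defs
begin

text \<open>
  Write \<open>\<mu>\<close> and \<open>\<mu>'\<close> for the invariant measures with digits \<open>{0, 2}\<close> and \<open>{0, 1}\<close> in base 4. They
  are the laws of \<open>X = \<Sum> 2 a\<^sub>k / 4\<^sup>k\<close> and \<open>Y = \<Sum> c\<^sub>k / 4\<^sup>k\<close> with independent fair bits \<open>a\<^sub>k, c\<^sub>k\<close>.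
  Since every base-4 digit is uniquely \<open>2 a + c\<close>, the sum \<open>X + Y\<close> is uniformly distributed on
  \<open>[0, 1]\<close>, and \<open>X\<close> can be read off from \<open>X + Y\<close>: it collects the binary digits in odd position.
  Let \<open>g\<close> denote this digit extraction on \<open>[0, 1]\<close>. Then \<open>f \<mapsto> f \<circ> g\<close> is an isometry from
  \<open>L\<^sup>2(\<mu>)\<close> into \<open>L\<^sup>2[0, 1]\<close>, and independence of \<open>X = g(X + Y)\<close> and \<open>Y\<close> gives
  \<open>(f \<circ> g)^(t) = (f d\<mu>)^(t) \<mu>'^(t)\<close> for every real \<open>t\<close> (lemmas \<open>L2_comp_odd_digits\<close> and
  \<open>fourier_fun_comp_odd_digits\<close>).

  All four claims are then known facts about \<open>L\<^sup>2[0, 1]\<close>, pulled back along this isometry: up to a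
  unimodular factor, the frame coefficients of \<open>f\<close> against \<open>\<bar>\<mu>'^(\<lambda>)\<bar> e\<^sub>\<lambda>\<close> are those of \<open>f \<circ> g\<close>
  against \<open>e\<^sub>\<lambda>\<close>. What is needed on \<open>[0, 1]\<close> is Parseval's identity for Fourier series and
  Plancherel's identity on the line. The latter follows from the former: apply Parseval's identity
  to \<open>F e\<^sub>-\<^sub>s\<close> and integrate over \<open>s \<in> [0, 1)\<close>.

  The invariant measures are only given through their invariance under the IFS. The joint law of
  \<open>(g, id - g)\<close> under Lebesgue measure is identified with \<open>\<mu> \<Otimes> \<mu>'\<close> as follows. Iterating the
  transfer operator of a contractive IFS sends every bounded Lipschitz function, in the
  limit, to the constant given by its integral (\<open>transfer_op_iterates_tendsto\<close>). Under Lebesgue measure, the integral of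
  \<open>u(g) v(id - g)\<close> does not change when both \<open>u\<close> and \<open>v\<close> are replaced by their images under the
  respective transfer operators (\<open>integral_transfer_digits\<close>), so in the limit it equals
  \<open>(\<integral> u d\<mu>) (\<integral> v d\<mu>')\<close>.
\<close>

section \<open>Exponentials and square-integrable functions\<close>

abbreviation unit_lebesgue :: "real measure" where
  "unit_lebesgue \<equiv> restrict_space lborel {0..1}"

lemma cmod_expo [simp]: "cmod (expo t x) = 1"
  by (simp add: expo_def)

lemma expo_0 [simp]: "expo 0 x = 1" "expo t 0 = 1"
  by (simp_all add: expo_def)

lemma expo_add: "expo (s + t) x = expo s x * expo t x"
  by (simp add: expo_def algebra_simps flip: exp_add)

lemma expo_add_right: "expo t (x + y) = expo t x * expo t y"
  by (simp add: expo_def algebra_simps flip: exp_add)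

lemma cnj_expo: "cnj (expo t x) = expo (- t) x"
  by (simp add: expo_def exp_cnj)

lemma continuous_on_expo: "continuous_on A (expo t)"
  unfolding expo_def[abs_def] by (intro continuous_intros)

lemma borel_measurable_expo [measurable (raw)]:
  assumes "f \<in> borel_measurable M" "g \<in> borel_measurable M"
  shows "(\<lambda>x. expo (f x) (g x)) \<in> borel_measurable M"
proof -
  have "(\<lambda>p::real \<times> real. expo (fst p) (snd p)) \<in> borel_measurable borel"
    unfolding expo_def by (intro borel_measurable_continuous_onI continuous_intros)
  from measurable_compose[OF _ this, of "\<lambda>x. (f x, g x)" M] assms show ?thesis
    by (simp add: borel_measurable_Pair)
qed

text \<open>This crude substitute for Minkowski's inequality suffices, because density arguments
  tolerate constant factors.\<close>

lemma cmod_add_power2_le: "(cmod (a + b))\<^sup>2 \<le> 2 * (cmod a)\<^sup>2 + 2 * (cmod b)\<^sup>2"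
proof -
  have "(cmod (a + b))\<^sup>2 \<le> (cmod a + cmod b)\<^sup>2"
    by (intro power_mono norm_triangle_ineq) simp
  also have "\<dots> \<le> 2 * (cmod a)\<^sup>2 + 2 * (cmod b)\<^sup>2"
    using sum_squares_bound[of "cmod a" "cmod b"] by (simp add: power2_sum)
  finally show ?thesis .
qed

lemma L2_measurable [measurable_dest]: "f \<in> L2 M \<Longrightarrow> f \<in> borel_measurable M"
  by (simp add: L2_def)

lemma L2_integrable_power2: "f \<in> L2 M \<Longrightarrow> integrable M (\<lambda>x. (cmod (f x))\<^sup>2)"
  by (simp add: L2_def)

lemma L2I_dominated:
  assumes "f \<in> borel_measurable M" "integrable M w" "\<And>x. x \<in> space M \<Longrightarrow> (cmod (f x))\<^sup>2 \<le> w x"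
  shows "f \<in> L2 M"
proof -
  have "integrable M (\<lambda>x. (cmod (f x))\<^sup>2)"
    using assms(1,3) by (intro Bochner_Integration.integrable_bound[OF assms(2)])
      (auto intro!: AE_I2 order_trans[OF _ abs_ge_self])
  then show ?thesis
    using assms(1) by (simp add: L2_def)
qed

lemma L2_add:
  assumes "f \<in> L2 M" "g \<in> L2 M"
  shows "(\<lambda>x. f x + g x) \<in> L2 M"
proof (rule L2I_dominated)
  show "integrable M (\<lambda>x. 2 * (cmod (f x))\<^sup>2 + 2 * (cmod (g x))\<^sup>2)"
    using assms by (intro Bochner_Integration.integrable_add integrable_mult_right L2_integrable_power2)
qed (use assms in \<open>auto intro: cmod_add_power2_le borel_measurable_add L2_measurable\<close>)

lemma L2_bounded_mult:
  assumes "f \<in> L2 M" "g \<in> borel_measurable M" "\<And>x. x \<in> space M \<Longrightarrow> cmod (g x) \<le> c"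
  shows "(\<lambda>x. g x * f x) \<in> L2 M"
proof (rule L2I_dominated)
  show "integrable M (\<lambda>x. c\<^sup>2 * (cmod (f x))\<^sup>2)"
    using assms(1) by (simp add: L2_def)
  show "(cmod (g x * f x))\<^sup>2 \<le> c\<^sup>2 * (cmod (f x))\<^sup>2" if "x \<in> space M" for x
    using assms(3)[OF that]
    by (auto simp: norm_mult power_mult_distrib intro!: mult_right_mono power_mono)
qed (use assms in \<open>auto simp: L2_def\<close>)

lemma L2_cmult: "f \<in> L2 M \<Longrightarrow> (\<lambda>x. c * f x) \<in> L2 M"
  using L2_bounded_mult[of f M "\<lambda>_. c" "cmod c"] by simp

lemma L2_diff: "f \<in> L2 M \<Longrightarrow> g \<in> L2 M \<Longrightarrow> (\<lambda>x. f x - g x) \<in> L2 M"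
  using L2_add[of f M "\<lambda>x. -1 * g x"] L2_cmult[of g M "-1"] by simp

lemma (in finite_measure) L2_bounded:
  assumes "f \<in> borel_measurable M" "\<And>x. x \<in> space M \<Longrightarrow> cmod (f x) \<le> c"
  shows "f \<in> L2 M"
  using assms by (intro L2I_dominated[where w = "\<lambda>_. c\<^sup>2"]) (auto intro!: power_mono)

lemma (in finite_measure) L2_integrable:
  assumes "f \<in> L2 M"
  shows "integrable M f"
proof (rule Bochner_Integration.integrable_bound)
  show "integrable M (\<lambda>x. 1 + (cmod (f x))\<^sup>2)"
    using assms by (simp add: L2_def)
  have "cmod (f x) \<le> 1 + (cmod (f x))\<^sup>2" for x
    using sum_squares_bound[of 1 "cmod (f x)"] norm_ge_zero[of "f x"] unfolding power2_eq_square by linarith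
  then show "AE x in M. norm (f x) \<le> norm (1 + (cmod (f x))\<^sup>2)"
    by (auto intro!: AE_I2 order_trans[OF _ abs_ge_self])
qed (use assms in \<open>simp add: L2_def\<close>)

lemma L2_norm_power2: "(L2_norm M f)\<^sup>2 = (LINT x|M. (cmod (f x))\<^sup>2)"
  by (simp add: L2_norm_def)

lemma L2_inner_expo: "L2_inner M f (\<lambda>x. complex_of_real c * expo t x) = c * fourier_fun M f t"
proof -
  have "L2_inner M f (\<lambda>x. complex_of_real c * expo t x) = (LINT x|M. c * (f x * expo (- t) x))"
    by (simp add: L2_inner_def cnj_expo mult_ac)
  then show ?thesis
    by (simp add: fourier_fun_def)
qed

interpretation unit_lebesgue: prob_space unit_lebesgue
  by (rule prob_spaceI) (simp add: emeasure_restrict_space space_restrict_space)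

lemma borel_measurable_unit_lebesgue:
  "f \<in> borel_measurable borel \<Longrightarrow> f \<in> borel_measurable unit_lebesgue"
  by (simp add: measurable_restrict_space1)

lemma borel_measurable_unit_lebesgue_ident [measurable]: "(\<lambda>x. x) \<in> borel_measurable unit_lebesgue"
  by (simp add: borel_measurable_unit_lebesgue)

lemma AE_unit_lebesgue_neq_1: "AE x in unit_lebesgue. 0 \<le> x \<and> x < 1"
proof -
  have "AE x in lborel. x \<noteq> (1::real)"
    by (rule AE_lborel_singleton)
  then have "AE x in lborel. x \<in> {0..1} \<longrightarrow> 0 \<le> x \<and> x < (1::real)"
    by eventually_elim auto
  then show ?thesis
    by (subst AE_restrict_space_iff) auto
qed

section \<open>Density of the trigonometric polynomials\<close>

inductive trig_poly :: "(real \<Rightarrow> complex) \<Rightarrow> bool" where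
  zero: "trig_poly (\<lambda>x. 0)"
| add_monomial: "trig_poly p \<Longrightarrow> trig_poly (\<lambda>x. c * expo (of_int n) x + p x)"

lemma trig_poly_add: "trig_poly p \<Longrightarrow> trig_poly q \<Longrightarrow> trig_poly (\<lambda>x. p x + q x)"
  by (induction rule: trig_poly.induct) (auto simp: add.assoc intro: trig_poly.add_monomial)

lemma trig_poly_monomial: "trig_poly (\<lambda>x. c * expo (of_int n) x)"
  using trig_poly.add_monomial[OF trig_poly.zero] by simp

lemma trig_poly_const: "trig_poly (\<lambda>x. c)"
  using trig_poly_monomial[of c 0] by simp

lemma trig_poly_monomial_mult:
  "trig_poly p \<Longrightarrow> trig_poly (\<lambda>x. c * expo (of_int n) x * p x)"
proof (induction rule: trig_poly.induct)
  case (add_monomial p d m)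
  have "trig_poly (\<lambda>x. (c * d) * expo (of_int (n + m)) x + c * expo (of_int n) x * p x)"
    by (rule trig_poly.add_monomial) (rule add_monomial.IH)
  then show ?case
    by (simp add: expo_add algebra_simps)
qed (use trig_poly.zero in simp)

lemma trig_poly_mult: "trig_poly p \<Longrightarrow> trig_poly q \<Longrightarrow> trig_poly (\<lambda>x. p x * q x)"
proof (induction rule: trig_poly.induct)
  case (add_monomial p c n)
  then show ?case
    using trig_poly_add[OF trig_poly_monomial_mult[of q c n], of "\<lambda>x. p x * q x"]
    by (simp add: distrib_right)
qed (use trig_poly.zero in simp)

lemma trig_poly_normal_form:
  assumes "trig_poly p"
  obtains J c where "finite J" "p = (\<lambda>x. \<Sum>n\<in>J. c n * expo (of_int n) x)"
proof -
  have "\<exists>J c. finite J \<and> p = (\<lambda>x. \<Sum>n\<in>J. c n * expo (of_int n) x)"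
    using assms
  proof (induction rule: trig_poly.induct)
    case zero
    show ?case by (intro exI[of _ "{}"]) simp
  next
    case (add_monomial p a m)
    then obtain J c where J: "finite J" "p = (\<lambda>x. \<Sum>n\<in>J. c n * expo (of_int n) x)"
      by blast
    define d where "d n = (if n \<in> J then c n else 0) + (if n = m then a else 0)" for n
    have "(\<Sum>n\<in>insert m J. d n * expo (of_int n) x) = a * expo (of_int m) x + p x" for x
    proof -
      have "(\<Sum>n\<in>insert m J. d n * expo (of_int n) x)
          = (\<Sum>n\<in>insert m J. (if n \<in> J then c n * expo (of_int n) x else 0))
            + (\<Sum>n\<in>insert m J. (if n = m then a * expo (of_int n) x else 0))"
        unfolding sum.distrib[symmetric] by (rule sum.cong) (auto simp: d_def distrib_right)
      also have "(\<Sum>n\<in>insert m J. (if n \<in> J then c n * expo (of_int n) x else 0)) = p x"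
        unfolding J(2) using J(1) by (intro sum.mono_neutral_cong_right) auto
      also have "(\<Sum>n\<in>insert m J. (if n = m then a * expo (of_int n) x else 0)) = a * expo (of_int m) x"
        using J(1) by (simp add: sum.delta)
      finally show ?thesis
        by simp
    qed
    then show ?case
      using J(1) by (intro exI[of _ "insert m J"] exI[of _ d]) auto
  qed
  then show thesis
    using that by blast
qed

lemma trig_poly_L2: "trig_poly p \<Longrightarrow> p \<in> L2 unit_lebesgue"
proof (induction rule: trig_poly.induct)
  case zero
  show ?case by (simp add: L2_def)
next
  case (add_monomial p c n)
  have "(\<lambda>x. c * expo (of_int n) x) \<in> L2 unit_lebesgue"
    by (rule unit_lebesgue.L2_bounded[where c = "cmod c"]) (auto simp: norm_mult)
  then show ?case
    using add_monomial.IH by (rule L2_add)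
qed

text \<open>A real-linear function of \<open>z = expo 1 x\<close> is a combination of \<open>z\<close> and its conjugate
  \<open>expo (-1) x\<close>, and trigonometric polynomials form an algebra. This turns the Stone-Weierstrass
  theorem on the unit circle into a statement about trigonometric polynomials.\<close>

lemma trig_poly_real_polynomial_circle:
  fixes P :: "complex \<Rightarrow> real"
  assumes "real_polynomial_function P"
  shows "trig_poly (\<lambda>x. of_real (P (expo 1 x)))"
  using assms
proof (induction rule: real_polynomial_function.induct)
  case (linear f)
  interpret f: bounded_linear f by fact
  define \<alpha> where "\<alpha> = Complex (f 1 / 2) (- f \<i> / 2)"
  define \<beta> where "\<beta> = Complex (f 1 / 2) (f \<i> / 2)"
  have eq: "complex_of_real (f z) = \<alpha> * z + \<beta> * cnj z" for z
  proof -
    have "f z = f (Re z *\<^sub>R 1 + Im z *\<^sub>R \<i>)"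
      by (rule arg_cong[where f = f]) (simp add: complex_eq_iff)
    also have "\<dots> = Re z * f 1 + Im z * f \<i>"
      by (simp add: f.add f.scaleR)
    finally show ?thesis
      by (simp add: complex_eq_iff \<alpha>_def \<beta>_def field_simps)
  qed
  have "trig_poly (\<lambda>x. \<alpha> * expo (of_int 1) x + \<beta> * expo (of_int (-1)) x)"
    by (intro trig_poly_add trig_poly_monomial)
  then show ?case
    by (simp add: eq cnj_expo)
qed (auto intro: trig_poly_const trig_poly_add trig_poly_mult)

definition L2_approximable :: "(real \<Rightarrow> complex) \<Rightarrow> bool" where
  "L2_approximable F \<longleftrightarrow> F \<in> L2 unit_lebesgue \<and>
     (\<forall>e>0. \<exists>p. trig_poly p \<and> (LINT x|unit_lebesgue. (cmod (F x - p x))\<^sup>2) < e)"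

lemma L2_approximable_L2: "L2_approximable F \<Longrightarrow> F \<in> L2 unit_lebesgue"
  by (simp add: L2_approximable_def)

lemma integral_power2_triangle:
  assumes "f \<in> L2 M" "g \<in> L2 M"
  shows "(LINT x|M. (cmod (f x + g x))\<^sup>2)
         \<le> 2 * (LINT x|M. (cmod (f x))\<^sup>2) + 2 * (LINT x|M. (cmod (g x))\<^sup>2)"
proof -
  have "(LINT x|M. (cmod (f x + g x))\<^sup>2) \<le> (LINT x|M. 2 * (cmod (f x))\<^sup>2 + 2 * (cmod (g x))\<^sup>2)"
    using assms L2_add[OF assms]
    by (intro integral_mono) (auto simp: L2_def intro!: cmod_add_power2_le)
  also have "\<dots> = 2 * (LINT x|M. (cmod (f x))\<^sup>2) + 2 * (LINT x|M. (cmod (g x))\<^sup>2)"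
    using assms by (simp add: L2_def)
  finally show ?thesis .
qed

lemma L2_approximable_trig_poly: "trig_poly p \<Longrightarrow> L2_approximable p"
  unfolding L2_approximable_def by (auto simp: trig_poly_L2 intro!: exI[of _ p])

lemma L2_approximable_closed:
  assumes F: "F \<in> L2 unit_lebesgue"
    and approx: "\<And>e. e > 0 \<Longrightarrow>
      \<exists>G. L2_approximable G \<and> (LINT x|unit_lebesgue. (cmod (F x - G x))\<^sup>2) < e"
  shows "L2_approximable F"
  unfolding L2_approximable_def
proof (intro conjI allI impI)
  fix e :: real assume "e > 0"
  then have e4: "e / 4 > 0" by simp
  obtain G where G: "L2_approximable G" "(LINT x|unit_lebesgue. (cmod (F x - G x))\<^sup>2) < e / 4"
    using approx[OF e4] by blast
  obtain p where p: "trig_poly p" "(LINT x|unit_lebesgue. (cmod (G x - p x))\<^sup>2) < e / 4"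
    using G(1) e4 unfolding L2_approximable_def by blast
  have "(LINT x|unit_lebesgue. (cmod ((F x - G x) + (G x - p x)))\<^sup>2)
      \<le> 2 * (LINT x|unit_lebesgue. (cmod (F x - G x))\<^sup>2)
        + 2 * (LINT x|unit_lebesgue. (cmod (G x - p x))\<^sup>2)"
    using F G(1) p(1) by (intro integral_power2_triangle L2_diff) (auto simp: L2_approximable_def trig_poly_L2)
  also have "\<dots> < e"
    using G(2) p(2) by simp
  finally show "\<exists>p. trig_poly p \<and> (LINT x|unit_lebesgue. (cmod (F x - p x))\<^sup>2) < e"
    using p(1) by (auto intro!: exI[of _ p])
qed fact

text \<open>Dominated convergence in \<open>L\<^sup>2\<close>. Each enlargement of the class of approximable functions below
  (closed arcs, countable disjoint unions, general square-integrable functions) is an instance.\<close>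

lemma L2_approximable_dominated:
  assumes F: "F \<in> borel_measurable unit_lebesgue"
    and s: "\<And>n::nat. L2_approximable (s n)"
    and lim: "AE x in unit_lebesgue. (\<lambda>n. s n x) \<longlonglongrightarrow> F x"
    and w: "integrable unit_lebesgue (\<lambda>x. (w x)\<^sup>2)"
      "\<And>n x. x \<in> {0..1} \<Longrightarrow> cmod (s n x) \<le> w x" "\<And>x. x \<in> {0..1} \<Longrightarrow> cmod (F x) \<le> w x"
  shows "L2_approximable F"
proof (rule L2_approximable_closed)
  show F2: "F \<in> L2 unit_lebesgue"
    using F w(1) by (rule L2I_dominated) (use w(3) in \<open>auto simp: space_restrict_space intro!: power_mono\<close>)
  have "(\<lambda>n. LINT x|unit_lebesgue. (cmod (F x - s n x))\<^sup>2) \<longlonglongrightarrow> (LINT x|unit_lebesgue. 0)"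
  proof (rule integral_dominated_convergence)
    show "integrable unit_lebesgue (\<lambda>x. 4 * (w x)\<^sup>2)"
      using w(1) by simp
    show "(\<lambda>x. (cmod (F x - s n x))\<^sup>2) \<in> borel_measurable unit_lebesgue" for n
    proof -
      have [measurable]: "s n \<in> borel_measurable unit_lebesgue"
        using s by (intro L2_measurable L2_approximable_L2)
      show ?thesis
        using F by measurable
    qed
    show "AE x in unit_lebesgue. (\<lambda>n. (cmod (F x - s n x))\<^sup>2) \<longlonglongrightarrow> 0"
      using lim
    proof eventually_elim
      case (elim x)
      have "(\<lambda>n. (cmod (F x - s n x))\<^sup>2) \<longlonglongrightarrow> (cmod (F x - F x))\<^sup>2"
        by (intro tendsto_intros elim)
      then show ?case by simp
    qed
    show "AE x in unit_lebesgue. norm ((cmod (F x - s n x))\<^sup>2) \<le> 4 * (w x)\<^sup>2" for n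
    proof (rule AE_I2)
      fix x assume "x \<in> space unit_lebesgue"
      then have x: "x \<in> {0..1}" by (simp add: space_restrict_space)
      have "cmod (F x - s n x) \<le> 2 * w x"
        using norm_triangle_ineq4[of "F x" "s n x"] w(2)[OF x, of n] w(3)[OF x] by simp
      then have "(cmod (F x - s n x))\<^sup>2 \<le> (2 * w x)\<^sup>2"
        by (intro power_mono) simp_all
      then show "norm ((cmod (F x - s n x))\<^sup>2) \<le> 4 * (w x)\<^sup>2"
        by (simp add: power_mult_distrib)
    qed
  qed simp
  then have lim0: "(\<lambda>n. LINT x|unit_lebesgue. (cmod (F x - s n x))\<^sup>2) \<longlonglongrightarrow> 0" by simp
  show "\<exists>G. L2_approximable G \<and> (LINT x|unit_lebesgue. (cmod (F x - G x))\<^sup>2) < e" if "e > 0" for e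
    using order_tendstoD(2)[OF lim0 that] s by (auto simp: eventually_sequentially)
qed

lemma L2_approximable_add:
  assumes "L2_approximable F" "L2_approximable G"
  shows "L2_approximable (\<lambda>x. F x + G x)"
  unfolding L2_approximable_def
proof (intro conjI allI impI)
  show "(\<lambda>x. F x + G x) \<in> L2 unit_lebesgue"
    using assms by (auto simp: L2_approximable_def intro: L2_add)
  fix e :: real assume "e > 0"
  then have e4: "e / 4 > 0" by simp
  obtain p where p: "trig_poly p" "(LINT x|unit_lebesgue. (cmod (F x - p x))\<^sup>2) < e / 4"
    using assms(1) e4 unfolding L2_approximable_def by blast
  obtain q where q: "trig_poly q" "(LINT x|unit_lebesgue. (cmod (G x - q x))\<^sup>2) < e / 4"
    using assms(2) e4 unfolding L2_approximable_def by blast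
  have "(LINT x|unit_lebesgue. (cmod ((F x - p x) + (G x - q x)))\<^sup>2)
      \<le> 2 * (LINT x|unit_lebesgue. (cmod (F x - p x))\<^sup>2)
        + 2 * (LINT x|unit_lebesgue. (cmod (G x - q x))\<^sup>2)"
    using assms p(1) q(1)
    by (intro integral_power2_triangle L2_diff) (auto simp: L2_approximable_def trig_poly_L2)
  also have "\<dots> < e"
    using p(2) q(2) by simp
  finally show "\<exists>r. trig_poly r \<and> (LINT x|unit_lebesgue. (cmod (F x + G x - r x))\<^sup>2) < e"
    using trig_poly_add[OF p(1) q(1)] by (auto simp: algebra_simps intro!: exI[of _ "\<lambda>x. p x + q x"])
qed

lemma L2_approximable_cmult:
  assumes "L2_approximable F"
  shows "L2_approximable (\<lambda>x. c * F x)"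
  unfolding L2_approximable_def
proof (intro conjI allI impI)
  show "(\<lambda>x. c * F x) \<in> L2 unit_lebesgue"
    using assms by (auto simp: L2_approximable_def intro: L2_cmult)
  fix e :: real assume "e > 0"
  have pos: "0 < 1 + (cmod c)\<^sup>2" by (simp add: add_pos_nonneg)
  obtain p where p: "trig_poly p"
      "(LINT x|unit_lebesgue. (cmod (F x - p x))\<^sup>2) < e / (1 + (cmod c)\<^sup>2)"
    using assms divide_pos_pos[OF \<open>e > 0\<close> pos] unfolding L2_approximable_def by blast
  have "(LINT x|unit_lebesgue. (cmod (c * F x - c * p x))\<^sup>2)
      = (LINT x|unit_lebesgue. (cmod c)\<^sup>2 * (cmod (F x - p x))\<^sup>2)"
    by (simp add: norm_mult power_mult_distrib flip: right_diff_distrib)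
  also have "\<dots> \<le> (1 + (cmod c)\<^sup>2) * (LINT x|unit_lebesgue. (cmod (F x - p x))\<^sup>2)"
    by (simp add: distrib_right)
  also have "\<dots> < e"
    using p(2) pos by (simp add: field_simps)
  finally show "\<exists>r. trig_poly r \<and> (LINT x|unit_lebesgue. (cmod (c * F x - r x))\<^sup>2) < e"
    using trig_poly_mult[OF trig_poly_const[of c] p(1)] by (auto intro!: exI[of _ "\<lambda>x. c * p x"])
qed

text \<open>Periodic continuous functions are represented as functions on the unit circle, so that the
  Stone-Weierstrass theorem for polynomial functions in the plane applies; uniform approximation
  gives approximation in \<open>L\<^sup>2\<close>.\<close>

lemma L2_approximable_circle:
  fixes \<phi> :: "complex \<Rightarrow> real"
  assumes "continuous_on (sphere 0 1) \<phi>"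
  shows "L2_approximable (\<lambda>x. of_real (\<phi> (expo 1 x)))"
proof (rule L2_approximable_closed)
  have meas: "(\<lambda>x. of_real (\<phi> (expo 1 x)) :: complex) \<in> borel_measurable borel"
    by (intro borel_measurable_continuous_onI continuous_on_of_real
        continuous_on_compose2[OF assms continuous_on_expo]) auto
  obtain b where b: "\<forall>z\<in>sphere 0 1. \<bar>\<phi> z\<bar> \<le> b"
    using compact_imp_bounded[OF compact_continuous_image[OF assms compact_sphere]]
    by (auto simp: bounded_iff)
  show "(\<lambda>x. of_real (\<phi> (expo 1 x))) \<in> L2 unit_lebesgue"
    using meas by (rule unit_lebesgue.L2_bounded[OF borel_measurable_unit_lebesgue, where c = b]) (simp add: b)
  fix e :: real assume "e > 0"
  then have e': "min 1 (e / 2) > 0" by simp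
  obtain P where P: "real_polynomial_function P"
      "\<And>z. z \<in> sphere 0 1 \<Longrightarrow> \<bar>\<phi> z - P z\<bar> < min 1 (e / 2)"
    using Stone_Weierstrass_real_polynomial_function[OF compact_sphere assms e'] by metis
  have T: "trig_poly (\<lambda>x. of_real (P (expo 1 x)))"
    by (rule trig_poly_real_polynomial_circle) fact
  have "(LINT x|unit_lebesgue. (cmod (of_real (\<phi> (expo 1 x)) - of_real (P (expo 1 x))))\<^sup>2)
      \<le> (LINT x|unit_lebesgue. e / 2)"
  proof (rule integral_mono')
    fix x
    let ?d = "\<phi> (expo 1 x) - P (expo 1 x)"
    have d: "\<bar>?d\<bar> \<le> 1" "\<bar>?d\<bar> \<le> e / 2"
      using P(2)[of "expo 1 x"] by simp_all
    have "(cmod (of_real (\<phi> (expo 1 x)) - of_real (P (expo 1 x))))\<^sup>2 = \<bar>?d\<bar> * \<bar>?d\<bar>"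
      by (simp add: power2_eq_square flip: of_real_diff)
    also have "\<dots> \<le> 1 * (e / 2)"
      using d by (intro mult_mono) auto
    finally show "(cmod (of_real (\<phi> (expo 1 x)) - of_real (P (expo 1 x))))\<^sup>2 \<le> e / 2" by simp
  qed (use \<open>e > 0\<close> in auto)
  also have "\<dots> < e"
    using \<open>e > 0\<close> unit_lebesgue.prob_space by simp
  finally show "\<exists>G. L2_approximable G \<and>
      (LINT x|unit_lebesgue. (cmod (of_real (\<phi> (expo 1 x)) - G x))\<^sup>2) < e"
    using L2_approximable_trig_poly[OF T] by (auto intro!: exI[of _ "\<lambda>x. of_real (P (expo 1 x))"])
qed

lemma expo_1_inj:
  assumes "expo 1 x = expo 1 y" "0 \<le> x" "x < 1" "0 \<le> y" "y < 1"
  shows "x = y"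
proof -
  obtain n :: int where "2 * complex_of_real pi * \<i> * x = 2 * complex_of_real pi * \<i> * y
      + of_int (2 * n) * pi * \<i>"
    using assms(1) by (auto simp: expo_def exp_eq)
  then have "(2 * complex_of_real pi * \<i>) * of_real x = (2 * complex_of_real pi * \<i>) * of_real (y + of_int n)"
    by (simp add: algebra_simps)
  then have "complex_of_real x = of_real (y + of_int n)"
    by simp
  then have "x = y + of_int n"
    using of_real_eq_iff by blast
  then show ?thesis
    using assms by (cases "n = 0") (auto simp: not_less)
qed

lemma L2_approximable_cong_AE:
  assumes "L2_approximable F" "G \<in> borel_measurable borel" "AE x in unit_lebesgue. F x = G x"
  shows "L2_approximable G"
proof -
  have G: "G \<in> borel_measurable unit_lebesgue"
    using assms(2) by (rule borel_measurable_unit_lebesgue)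
  have F: "F \<in> L2 unit_lebesgue" using assms(1) by (simp add: L2_approximable_def)
  have "integrable unit_lebesgue (\<lambda>x. (cmod (G x))\<^sup>2) \<longleftrightarrow> integrable unit_lebesgue (\<lambda>x. (cmod (F x))\<^sup>2)"
    using assms(3) F G by (intro integrable_cong_AE) (auto simp: L2_def)
  then have "G \<in> L2 unit_lebesgue"
    using F G by (simp add: L2_def)
  moreover have "(LINT x|unit_lebesgue. (cmod (G x - F x))\<^sup>2) = (LINT x|unit_lebesgue. 0)"
    using assms(3) F G by (intro integral_cong_AE) (auto simp: L2_def)
  ultimately show ?thesis
    using assms(1) by (intro L2_approximable_closed) auto
qed

text \<open>For \<open>0 \<le> b < 1\<close> the interval \<open>[0, b]\<close> is wrapped injectively onto a closed arc of the unit
  circle, whose indicator is the limit of the continuous functions \<open>max 0 (1 - n dist z C)\<close>. The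
  point \<open>1\<close>, which the wrapping identifies with \<open>0\<close>, is a null set.\<close>

lemma L2_approximable_indicator_atMost:
  "L2_approximable (indicator {..b::real})"
proof -
  consider "b < 0" | "1 \<le> b" | "0 \<le> b" "b < 1" by linarith
  then show ?thesis
  proof cases
    case 1
    show ?thesis
      by (rule L2_approximable_cong_AE[OF L2_approximable_trig_poly[OF trig_poly_const[of 0]]])
         (use 1 in \<open>auto simp: indicator_def space_restrict_space intro!: AE_I2\<close>)
  next
    case 2
    show ?thesis
      by (rule L2_approximable_cong_AE[OF L2_approximable_trig_poly[OF trig_poly_const[of 1]]])
         (use 2 in \<open>auto simp: indicator_def space_restrict_space intro!: AE_I2\<close>)
  next
    case 3
    define C where "C = expo 1 ` {0..b}"
    have C: "compact C" "C \<noteq> {}"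
      unfolding C_def using 3
      by (auto intro!: compact_continuous_image continuous_on_expo)
    define \<phi> where "\<phi> n z = max 0 (1 - real n * infdist z C)" for n z
    show ?thesis
    proof (rule L2_approximable_dominated)
      show "indicator {..b} \<in> borel_measurable unit_lebesgue" by simp
      show "L2_approximable (\<lambda>x. of_real (\<phi> n (expo 1 x)))" for n
        unfolding \<phi>_def by (intro L2_approximable_circle continuous_intros continuous_on_infdist)
      show "integrable unit_lebesgue (\<lambda>x. 1\<^sup>2 :: real)" by simp
      show "cmod (of_real (\<phi> n (expo 1 x))) \<le> 1" for n x
        by (simp add: \<phi>_def infdist_nonneg)
      show "cmod (indicator {..b} x) \<le> 1" for x
        by (simp add: indicator_def)
      show "AE x in unit_lebesgue. (\<lambda>n. of_real (\<phi> n (expo 1 x))) \<longlonglongrightarrow> (indicator {..b} x :: complex)"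
        using AE_unit_lebesgue_neq_1
      proof eventually_elim
        case (elim x)
        show ?case
        proof (cases "x \<le> b")
          case True
          then have "expo 1 x \<in> C"
            unfolding C_def using elim by auto
          then show ?thesis
            using True by (simp add: \<phi>_def)
        next
          case False
          have "expo 1 x \<notin> C"
          proof
            assume "expo 1 x \<in> C"
            then obtain y where "expo 1 x = expo 1 y" "0 \<le> y" "y \<le> b"
              unfolding C_def by auto
            with expo_1_inj[of x y] elim 3 False show False by simp
          qed
          then have pos: "infdist (expo 1 x) C > 0"
            using C in_closed_iff_infdist_zero[of C "expo 1 x"] infdist_nonneg[of "expo 1 x" C]
            by (simp add: compact_imp_closed less_le)
          obtain N :: nat where N: "real N * infdist (expo 1 x) C > 1"
            using reals_Archimedean3[OF pos] by auto
          have "\<phi> n (expo 1 x) = 0" if "n \<ge> N" for n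
          proof -
            have "real N * infdist (expo 1 x) C \<le> real n * infdist (expo 1 x) C"
              using that pos by (intro mult_right_mono) auto
            then show ?thesis
              using N by (simp add: \<phi>_def)
          qed
          then have "\<forall>\<^sub>F n in sequentially. complex_of_real (\<phi> n (expo 1 x)) = 0"
            by (auto simp: eventually_sequentially)
          then show ?thesis
            using False by (simp add: tendsto_eventually)
        qed
      qed
    qed
  qed
qed

text \<open>The half-lines are a \<open>\<pi>\<close>-system generating the Borel sets, and the sets with approximable
  indicator form a Dynkin system.\<close>

lemma L2_approximable_indicator:
  assumes "E \<in> sets borel"
  shows "L2_approximable (indicator E)"
proof -
  have "Int_stable (range (\<lambda>a::real. {..a}))" "range (\<lambda>a::real. {..a}) \<subseteq> Pow UNIV"
    by (auto simp: Int_stable_def)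
  moreover have "E \<in> sigma_sets UNIV (range (\<lambda>a::real. {..a}))"
    using assms by (simp add: borel_eq_atMost)
  ultimately show ?thesis
  proof (induction rule: sigma_sets_induct_disjoint)
    case (basic A)
    then show ?case
      using L2_approximable_indicator_atMost by auto
  next
    case empty
    show ?case
      using L2_approximable_trig_poly[OF trig_poly_const[of 0]] by simp
  next
    case (compl A)
    have "L2_approximable (\<lambda>x. 1 + -1 * indicator A x)"
      by (intro L2_approximable_add L2_approximable_cmult compl.IH
          L2_approximable_trig_poly trig_poly_const)
    also have "(\<lambda>x. 1 + -1 * indicator A x) = (indicator (UNIV - A) :: real \<Rightarrow> complex)"
      by (auto simp: indicator_def)
    finally show ?case .
  next
    case (union A)
    have sets: "A i \<in> sets borel" for i
      using union(2) by (auto simp: borel_eq_atMost)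
    have fin: "L2_approximable (indicator (\<Union>i<n. A i))" for n
    proof (induction n)
      case 0
      show ?case
        using L2_approximable_trig_poly[OF trig_poly_const[of 0]] by simp
    next
      case (Suc n)
      have "(\<Union>i<n. A i) \<inter> A n = {}"
        using disjoint_family_onD[OF union(1)] by (fastforce dest: less_imp_neq)
      then have "indicator (\<Union>i<Suc n. A i) = (\<lambda>x. indicator (\<Union>i<n. A i) x + indicator (A n) x :: complex)"
        by (intro ext) (auto simp: indicator_def lessThan_Suc)
      then show ?case
        using L2_approximable_add[OF Suc union(3)] by simp
    qed
    show ?case
    proof (rule L2_approximable_dominated[OF _ fin])
      show "AE x in unit_lebesgue.
          (\<lambda>n. indicator (\<Union>i<n. A i) x) \<longlonglongrightarrow> (indicator (\<Union>i. A i) x :: complex)"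
        by (intro AE_I2 LIMSEQ_indicator_UN)
      show "integrable unit_lebesgue (\<lambda>x. 1\<^sup>2 :: real)" by simp
      show "indicator (\<Union>i. A i) \<in> borel_measurable unit_lebesgue"
        using sets by (intro borel_measurable_unit_lebesgue borel_measurable_indicator) auto
    qed (auto simp: indicator_def)
  qed
qed

lemma trig_poly_dense_L2:
  assumes F: "F \<in> L2 unit_lebesgue"
  shows "L2_approximable F"
proof -
  obtain s where s: "\<And>i. simple_function unit_lebesgue (s i)"
      "\<And>x. x \<in> space unit_lebesgue \<Longrightarrow> (\<lambda>i. s i x) \<longlonglongrightarrow> F x"
      "\<And>i x. x \<in> space unit_lebesgue \<Longrightarrow> dist (s i x) 0 \<le> 2 * dist (F x) 0"
    using borel_measurable_implies_sequence_metric[OF L2_measurable[OF F], of 0] by metis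
  define S where "S i x = (\<Sum>y\<in>s i ` space unit_lebesgue.
      indicator (s i -` {y} \<inter> space unit_lebesgue) x *\<^sub>R y)" for i x
  have S: "S i x = s i x" if "x \<in> space unit_lebesgue" for i x
    unfolding S_def by (rule simple_function_indicator_representation_banach[OF s(1) that, symmetric])
  have simple: "L2_approximable (S i)" for i
  proof -
    define B where "B y = s i -` {y} \<inter> space unit_lebesgue" for y
    have B: "B y \<in> sets borel" for y
      using simple_functionD(2)[OF s(1), of i "{y}"] by (simp add: B_def sets_restrict_space_iff)
    have ind: "indicator (B y) x *\<^sub>R y = y * indicator (B y) x" for x and y :: complex
      by (simp add: indicator_def)
    have "L2_approximable (\<lambda>x. \<Sum>y\<in>Y. indicator (B y) x *\<^sub>R y)" if "finite Y" for Y
      using that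
    proof induction
      case empty
      show ?case
        using L2_approximable_trig_poly[OF trig_poly_const[of 0]] by simp
    next
      case (insert y Y)
      then have "L2_approximable (\<lambda>x. y * indicator (B y) x + (\<Sum>z\<in>Y. indicator (B z) x *\<^sub>R z))"
        by (intro L2_approximable_add L2_approximable_cmult L2_approximable_indicator B)
      then show ?case
        using insert.hyps by (simp only: sum.insert ind not_False_eq_True)
    qed
    from this[OF simple_functionD(1)[OF s(1)]] show ?thesis
      unfolding B_def S_def[abs_def] .
  qed
  show ?thesis
  proof (rule L2_approximable_dominated)
    show "F \<in> borel_measurable unit_lebesgue"
      using F by (rule L2_measurable)
    show "L2_approximable (S i)" for i
      by (rule simple)
    show "AE x in unit_lebesgue. (\<lambda>i. S i x) \<longlonglongrightarrow> F x"
      using s(2) by (intro AE_I2) (simp add: S)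
    show "integrable unit_lebesgue (\<lambda>x. (2 * cmod (F x))\<^sup>2)"
      using L2_integrable_power2[OF F] by (simp add: power_mult_distrib)
    show "cmod (S i x) \<le> 2 * cmod (F x)" if "x \<in> {0..1}" for i x
      using S[of x i] s(3)[of x i] that by (simp add: space_restrict_space)
    show "cmod (F x) \<le> 2 * cmod (F x)" for x
      by simp
  qed
qed

section \<open>The Plancherel identities on the unit interval\<close>

lemma integral_expo_unit_interval:
  "(LINT x|unit_lebesgue. expo (of_int n) x) = (if n = 0 then 1 else 0)"
proof (cases "n = 0")
  case True
  then show ?thesis
    using unit_lebesgue.prob_space by simp
next
  case False
  define w where "w = 2 * complex_of_real pi * \<i> * of_int n"
  have w: "w \<noteq> 0" using False by (simp add: w_def)
  have "(LINT x|unit_lebesgue. expo (of_int n) x) = (LINT x:{0..1}|lborel. expo (of_int n) x)"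
    by (simp add: integral_restrict_space set_lebesgue_integral_def)
  also have "\<dots> = integral {0..1} (expo (of_int n))"
    by (intro set_borel_integral_eq_integral borel_integrable_atLeastAtMost' continuous_on_expo)
  also have "\<dots> = expo (of_int n) 1 / w - expo (of_int n) 0 / w"
  proof (rule integral_unique, rule fundamental_theorem_of_calculus)
    fix x :: real
    have "((\<lambda>z. exp (w * z) / w) has_field_derivative exp (w * of_real x)) (at (of_real x))"
      using w by (auto intro!: derivative_eq_intros)
    from has_vector_derivative_real_field[OF this]
    show "((\<lambda>x. expo (of_int n) x / w) has_vector_derivative expo (of_int n) x) (at x within {0..1})"
      by (simp add: expo_def w_def)
  qed simp
  also have "expo (of_int n) 1 = 1"
    unfolding expo_def exp_eq_1 by (auto simp: mult_ac intro!: exI[of _ n])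
  finally show ?thesis
    using False by simp
qed

lemma borel_measurable_expo_unit_lebesgue: "expo t \<in> borel_measurable unit_lebesgue"
  by (intro borel_measurable_unit_lebesgue borel_measurable_continuous_onI continuous_on_expo)

lemma L2_expo_unit_lebesgue: "expo t \<in> L2 unit_lebesgue"
  by (rule unit_lebesgue.L2_bounded[OF borel_measurable_expo_unit_lebesgue, where c = 1]) simp

lemma integrable_mult_expo_unit_lebesgue:
  assumes "F \<in> L2 unit_lebesgue"
  shows "integrable unit_lebesgue (\<lambda>x. F x * expo t x)"
  using unit_lebesgue.L2_integrable[OF L2_bounded_mult[OF assms borel_measurable_expo_unit_lebesgue[of t], where c = 1]]
  by (simp add: mult.commute)

lemma fourier_fun_unit_lebesgue_diff_monomial:
  assumes "F \<in> L2 unit_lebesgue"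
  shows "fourier_fun unit_lebesgue (\<lambda>x. F x - c * expo (of_int n) x) (of_int m)
         = fourier_fun unit_lebesgue F (of_int m) - (if m = n then c else 0)"
proof -
  have "(F x - c * expo (of_int n) x) * expo (- of_int m) x
      = F x * expo (- of_int m) x - c * expo (of_int (n - m)) x" for x
    using expo_add[of "of_int n" "- of_int m" x] by (simp add: algebra_simps)
  then have "fourier_fun unit_lebesgue (\<lambda>x. F x - c * expo (of_int n) x) (of_int m)
      = (LINT x|unit_lebesgue. F x * expo (- of_int m) x - c * expo (of_int (n - m)) x)"
    by (simp add: fourier_fun_def)
  also have "\<dots> = fourier_fun unit_lebesgue F (of_int m) - c * (LINT x|unit_lebesgue. expo (of_int (n - m)) x)"
    unfolding fourier_fun_def using integrable_mult_expo_unit_lebesgue[OF assms, of "- of_int m"]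
      unit_lebesgue.L2_integrable[OF L2_expo_unit_lebesgue, of "of_int (n - m)"]
    by (subst Bochner_Integration.integral_diff) simp_all
  finally show ?thesis
    unfolding integral_expo_unit_interval by auto
qed

lemma integral_power2_diff_monomial:
  assumes F: "F \<in> L2 unit_lebesgue"
  shows "(LINT x|unit_lebesgue. (cmod (F x - c * expo t x))\<^sup>2)
         = (LINT x|unit_lebesgue. (cmod (F x))\<^sup>2) - (cmod (fourier_fun unit_lebesgue F t))\<^sup>2
           + (cmod (c - fourier_fun unit_lebesgue F t))\<^sup>2"
proof -
  let ?a = "fourier_fun unit_lebesgue F t"
  note int = integrable_mult_expo_unit_lebesgue[OF F, of "- t"]
  have eq: "(cmod (z - w))\<^sup>2 = (cmod z)\<^sup>2 - 2 * Re (cnj w * z) + (cmod w)\<^sup>2" for z w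
    unfolding cmod_power2 by (simp add: power2_eq_square algebra_simps)
  have "(cmod (F x - c * expo t x))\<^sup>2
      = (cmod (F x))\<^sup>2 - 2 * Re (cnj c * (F x * expo (- t) x)) + (cmod c)\<^sup>2" for x
    unfolding eq by (simp add: cnj_expo norm_mult mult_ac)
  then have "(LINT x|unit_lebesgue. (cmod (F x - c * expo t x))\<^sup>2)
      = (LINT x|unit_lebesgue. (cmod (F x))\<^sup>2 - 2 * Re (cnj c * (F x * expo (- t) x)) + (cmod c)\<^sup>2)"
    by simp
  also have "\<dots> = (LINT x|unit_lebesgue. (cmod (F x))\<^sup>2)
      - (LINT x|unit_lebesgue. 2 * Re (cnj c * (F x * expo (- t) x))) + (LINT x|unit_lebesgue. (cmod c)\<^sup>2)"
  proof -
    have i: "integrable unit_lebesgue (\<lambda>x. 2 * Re (cnj c * (F x * expo (- t) x)))"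
      using int by (intro integrable_mult_right integrable_Re)
    show ?thesis
      unfolding Bochner_Integration.integral_add[OF
          Bochner_Integration.integrable_diff[OF L2_integrable_power2[OF F] i] unit_lebesgue.integrable_const]
        Bochner_Integration.integral_diff[OF L2_integrable_power2[OF F] i] ..
  qed
  also have "(LINT x|unit_lebesgue. (cmod c)\<^sup>2) = (cmod c)\<^sup>2"
    using unit_lebesgue.prob_space by simp
  also have "(LINT x|unit_lebesgue. 2 * Re (cnj c * (F x * expo (- t) x)))
      = 2 * (LINT x|unit_lebesgue. Re (cnj c * (F x * expo (- t) x)))"
    by (rule integral_mult_right_zero)
  also have "(LINT x|unit_lebesgue. Re (cnj c * (F x * expo (- t) x))) = Re (cnj c * ?a)"
    unfolding fourier_fun_def using int by (subst integral_Re) (simp_all only: integrable_mult_right integral_mult_right_zero)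
  also have "(LINT x|unit_lebesgue. (cmod (F x))\<^sup>2) - 2 * Re (cnj c * ?a) + (cmod c)\<^sup>2
      = (LINT x|unit_lebesgue. (cmod (F x))\<^sup>2) - (cmod ?a)\<^sup>2 + (cmod (c - ?a))\<^sup>2"
    unfolding cmod_power2 by (simp add: power2_eq_square algebra_simps)
  finally show ?thesis .
qed

text \<open>Orthogonal projection with its error term: the left-hand side is smallest for the Fourier
  coefficients. Dropping the last sum bounds the distance to any trigonometric polynomial from
  below; taking \<open>c\<close> to be the Fourier coefficients gives Bessel's inequality.\<close>

lemma integral_power2_diff_trig_sum:
  assumes F: "F \<in> L2 unit_lebesgue" and J: "finite J"
  shows "(LINT x|unit_lebesgue. (cmod (F x - (\<Sum>n\<in>J. c n * expo (of_int n) x)))\<^sup>2)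
         = (LINT x|unit_lebesgue. (cmod (F x))\<^sup>2)
           - (\<Sum>n\<in>J. (cmod (fourier_fun unit_lebesgue F (of_int n)))\<^sup>2)
           + (\<Sum>n\<in>J. (cmod (c n - fourier_fun unit_lebesgue F (of_int n)))\<^sup>2)"
  using J F
proof (induction J arbitrary: F)
  case (insert n J)
  define G where "G = (\<lambda>x. F x - c n * expo (of_int n) x)"
  have G: "G \<in> L2 unit_lebesgue"
    unfolding G_def using insert.prems by (intro L2_diff L2_cmult L2_expo_unit_lebesgue)
  have coeff: "fourier_fun unit_lebesgue G (of_int m) = fourier_fun unit_lebesgue F (of_int m)"
    if "m \<in> J" for m
    using that insert.hyps(2) fourier_fun_unit_lebesgue_diff_monomial[OF insert.prems, of "c n" n m]
    by (auto simp: G_def)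
  have "(LINT x|unit_lebesgue. (cmod (F x - (\<Sum>n\<in>insert n J. c n * expo (of_int n) x)))\<^sup>2)
      = (LINT x|unit_lebesgue. (cmod (G x - (\<Sum>n\<in>J. c n * expo (of_int n) x)))\<^sup>2)"
    using insert.hyps by (simp add: G_def algebra_simps)
  also have "\<dots> = (LINT x|unit_lebesgue. (cmod (G x))\<^sup>2)
           - (\<Sum>m\<in>J. (cmod (fourier_fun unit_lebesgue F (of_int m)))\<^sup>2)
           + (\<Sum>m\<in>J. (cmod (c m - fourier_fun unit_lebesgue F (of_int m)))\<^sup>2)"
    unfolding insert.IH[OF G] by (simp add: coeff cong: sum.cong)
  finally show ?case
    using insert.hyps unfolding G_def integral_power2_diff_monomial[OF insert.prems] by simp
qed simp

text \<open>Bessel's inequality bounds all finite partial sums by the integral. Conversely, a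
  trigonometric polynomial close to \<open>F\<close> shows that the partial sum over its frequencies is close to
  the integral.\<close>

theorem parseval_unit_interval:
  assumes F: "F \<in> L2 unit_lebesgue"
  shows "((\<lambda>n::int. (cmod (fourier_fun unit_lebesgue F (of_int n)))\<^sup>2)
           has_sum (LINT x|unit_lebesgue. (cmod (F x))\<^sup>2)) UNIV"
proof -
  let ?a = "\<lambda>n::int. (cmod (fourier_fun unit_lebesgue F (of_int n)))\<^sup>2"
  let ?I = "LINT x|unit_lebesgue. (cmod (F x))\<^sup>2"
  have bessel: "sum ?a J \<le> ?I" if "finite J" for J
  proof -
    have "0 \<le> (LINT x|unit_lebesgue. (cmod (F x - (\<Sum>n\<in>J. fourier_fun unit_lebesgue F (of_int n) * expo (of_int n) x)))\<^sup>2)"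
      by simp
    then show ?thesis
      unfolding integral_power2_diff_trig_sum[OF F that] by simp
  qed
  have "\<exists>J. finite J \<and> (\<forall>J'. finite J' \<and> J \<subseteq> J' \<longrightarrow> dist (sum ?a J') ?I < e)" if e: "e > 0" for e
  proof -
    obtain p where p: "trig_poly p" "(LINT x|unit_lebesgue. (cmod (F x - p x))\<^sup>2) < e"
      using trig_poly_dense_L2[OF F] e unfolding L2_approximable_def by blast
    obtain J c where J: "finite J" "p = (\<lambda>x. \<Sum>n\<in>J. c n * expo (of_int n) x)"
      using p(1) by (rule trig_poly_normal_form)
    have "?I - sum ?a J \<le> (LINT x|unit_lebesgue. (cmod (F x - p x))\<^sup>2)"
      unfolding J(2) integral_power2_diff_trig_sum[OF F J(1)] by (simp add: sum_nonneg)
    then have "?I - sum ?a J < e"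
      using p(2) by simp
    moreover have "sum ?a J \<le> sum ?a J'" if "finite J'" "J \<subseteq> J'" for J'
      using that by (intro sum_mono2) auto
    ultimately show ?thesis
      using J(1) bessel by (intro exI[of _ J]) (force simp: dist_real_def abs_if)
  qed
  then show ?thesis
    unfolding has_sum_def tendsto_iff eventually_finite_subsets_at_top by auto
qed

lemma L2_frame_unit_expo: "L2_frame unit_lebesgue (\<lambda>n::int. expo (of_int n)) 1 1"
proof -
  have inner: "L2_inner unit_lebesgue v (expo t) = fourier_fun unit_lebesgue v t" for v t
    using L2_inner_expo[of unit_lebesgue v 1 t] by simp
  show ?thesis
    unfolding L2_frame_def inner L2_norm_power2
    using has_sum_imp_summable[OF parseval_unit_interval] infsumI[OF parseval_unit_interval]
    by (auto simp: L2_expo_unit_lebesgue)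
qed

lemma nn_integral_parseval_unit_interval:
  assumes F: "F \<in> L2 unit_lebesgue"
  shows "(\<integral>\<^sup>+ (n::int). ennreal ((cmod (fourier_fun unit_lebesgue F (of_int n)))\<^sup>2) \<partial>count_space UNIV)
         = ennreal (LINT x|unit_lebesgue. (cmod (F x))\<^sup>2)"
proof -
  let ?a = "\<lambda>n::int. (cmod (fourier_fun unit_lebesgue F (of_int n)))\<^sup>2"
  have abs: "Infinite_Set_Sum.abs_summable_on ?a UNIV"
    using has_sum_imp_summable[OF parseval_unit_interval[OF F]] by (simp flip: abs_summable_equivalent)
  then show ?thesis
    using nn_integral_conv_infsetsum[OF abs] infsetsum_infsum[OF abs] infsumI[OF parseval_unit_interval[OF F]]
    by simp
qed

text \<open>The line is cut into the intervals \<open>[n, n + 1)\<close>, each of which is translated to \<open>[0, 1)\<close>.\<close>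

lemma nn_integral_periodization:
  fixes \<phi> :: "real \<Rightarrow> ennreal"
  assumes [measurable]: "\<phi> \<in> borel_measurable borel"
  shows "(\<integral>\<^sup>+ x. \<phi> x \<partial>lborel)
         = (\<integral>\<^sup>+ s. (\<integral>\<^sup>+ (n::int). \<phi> (of_int n + s) \<partial>count_space UNIV) * indicator {0..<1} s \<partial>lborel)"
proof -
  have "\<phi> x = (\<integral>\<^sup>+ (n::int). \<phi> x * indicator {of_int n..<of_int n + 1} x \<partial>count_space UNIV)" for x
  proof -
    have "indicator {of_int n..<of_int n + 1} x = (indicator {\<lfloor>x\<rfloor>} n :: ennreal)" for n :: int
      by (auto simp: indicator_def dest: floor_unique)
    then show ?thesis
      by (simp add: nn_integral_cmult)
  qed
  then have "(\<integral>\<^sup>+ x. \<phi> x \<partial>lborel)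
      = (\<integral>\<^sup>+ x. (\<integral>\<^sup>+ (n::int). \<phi> x * indicator {of_int n..<of_int n + 1} x \<partial>count_space UNIV) \<partial>lborel)"
    by simp
  also have "\<dots> = (\<integral>\<^sup>+ (n::int). (\<integral>\<^sup>+ x. \<phi> x * indicator {of_int n..<of_int n + 1} x \<partial>lborel) \<partial>count_space UNIV)"
    by (rule nn_integral_count_space_nn_integral) auto
  also have "\<dots> = (\<integral>\<^sup>+ (n::int). (\<integral>\<^sup>+ s. \<phi> (of_int n + s) * indicator {0..<1} s \<partial>lborel) \<partial>count_space UNIV)"
  proof (rule nn_integral_cong)
    fix n :: int
    have "(\<integral>\<^sup>+ x. \<phi> x * indicator {of_int n..<of_int n + 1} x \<partial>lborel)
        = (\<integral>\<^sup>+ s. \<phi> (of_int n + s) * indicator {of_int n..<of_int n + 1} (of_int n + s) \<partial>lborel)"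
      using nn_integral_real_affine[of "\<lambda>x. \<phi> x * indicator {of_int n..<of_int n + 1} x" 1 "of_int n"] by simp
    also have "\<dots> = (\<integral>\<^sup>+ s. \<phi> (of_int n + s) * indicator {0..<1} s \<partial>lborel)"
      by (intro nn_integral_cong) (auto simp: indicator_def)
    finally show "(\<integral>\<^sup>+ x. \<phi> x * indicator {of_int n..<of_int n + 1} x \<partial>lborel)
        = (\<integral>\<^sup>+ s. \<phi> (of_int n + s) * indicator {0..<1} s \<partial>lborel)" .
  qed
  also have "\<dots> = (\<integral>\<^sup>+ s. (\<integral>\<^sup>+ (n::int). \<phi> (of_int n + s) * indicator {0..<1} s \<partial>count_space UNIV) \<partial>lborel)"
    by (rule nn_integral_count_space_nn_integral[symmetric]) auto
  finally show ?thesis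
    by (simp add: nn_integral_multc)
qed

lemma borel_measurable_fourier_fun:
  assumes "sigma_finite_measure M" "f \<in> borel_measurable M" "(\<lambda>x. x) \<in> borel_measurable M"
  shows "fourier_fun M f \<in> borel_measurable borel"
proof -
  interpret sigma_finite_measure M by fact
  note [measurable] = assms(2,3)
  have "(\<lambda>t. LINT x|M. f x * expo (- t) x) \<in> borel_measurable borel"
    by measurable
  then show ?thesis
    by (simp add: fourier_fun_def[abs_def])
qed

text \<open>Sampling the Fourier transform of \<open>F\<close> at \<open>n + s\<close> gives the Fourier coefficients of
  \<open>F\<close> times a unimodular function. By Parseval's identity the sum of their squares is the same for
  every \<open>s \<in> [0, 1)\<close>, and integrating over \<open>s\<close> covers the line once.\<close>

theorem plancherel_unit_interval:
  assumes F: "F \<in> L2 unit_lebesgue"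
  shows "(\<integral>\<^sup>+ t. ennreal ((cmod (fourier_fun unit_lebesgue F t))\<^sup>2) \<partial>lborel)
         = ennreal (LINT x|unit_lebesgue. (cmod (F x))\<^sup>2)"
proof -
  have shift: "fourier_fun unit_lebesgue F (of_int n + s)
      = fourier_fun unit_lebesgue (\<lambda>x. expo (- s) x * F x) (of_int n)" for n :: int and s
    using expo_add[of "- of_int n" "- s"] by (simp add: fourier_fun_def mult_ac)
  have Fs: "(\<lambda>x. expo (- s) x * F x) \<in> L2 unit_lebesgue" for s
    using F by (rule L2_bounded_mult[OF _ borel_measurable_expo_unit_lebesgue, where c = 1]) simp
  have [measurable]: "fourier_fun unit_lebesgue F \<in> borel_measurable borel"
    by (intro borel_measurable_fourier_fun L2_measurable[OF F] unit_lebesgue.sigma_finite_measure_axioms) simp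
  have "(\<integral>\<^sup>+ t. ennreal ((cmod (fourier_fun unit_lebesgue F t))\<^sup>2) \<partial>lborel)
      = (\<integral>\<^sup>+ s. (\<integral>\<^sup>+ (n::int). ennreal ((cmod (fourier_fun unit_lebesgue F (of_int n + s)))\<^sup>2) \<partial>count_space UNIV)
           * indicator {0..<1} s \<partial>lborel)"
    by (rule nn_integral_periodization) measurable
  also have "\<dots> = (\<integral>\<^sup>+ s. ennreal (LINT x|unit_lebesgue. (cmod (F x))\<^sup>2) * indicator {0..<1::real} s \<partial>lborel)"
    unfolding shift nn_integral_parseval_unit_interval[OF Fs] by (simp add: norm_mult)
  finally show ?thesis
    by (simp add: nn_integral_cmult)
qed

section \<open>The transfer operator of an affine IFS\<close>

text \<open>The Ruelle operator with constant weights. A probability measure is invariant under the IFS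
  iff it is fixed by the adjoint of this operator.\<close>

definition transfer_op :: "int \<Rightarrow> int set \<Rightarrow> (real \<Rightarrow> real) \<Rightarrow> real \<Rightarrow> real" where
  "transfer_op R B u x = (\<Sum>b\<in>B. u (ifs_map R b x)) / real (card B)"

text \<open>Nonemptiness of the digit set makes \<open>card B\<close> a nonzero divisor.\<close>

locale ifs_measure =
  fixes R :: int and B :: "int set" and \<mu> :: "real measure"
  assumes invariant: "ifs_invariant_measure R B \<mu>" and nonempty: "B \<noteq> {}"
begin

lemma R_ge_2: "2 \<le> R" and finite_B: "finite B" and sets_\<mu>: "sets \<mu> = sets borel"
  using invariant by (auto simp: ifs_invariant_measure_def)

lemma card_B_pos: "0 < card B"
  using finite_B nonempty by (simp add: card_gt_0_iff)

sublocale prob_space \<mu>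
  using invariant by (simp add: ifs_invariant_measure_def)

lemma space_\<mu> [simp]: "space \<mu> = UNIV"
  using sets_eq_imp_space_eq[OF sets_\<mu>] by simp

lemma borel_measurable_\<mu>: "borel_measurable \<mu> = borel_measurable borel"
  by (rule measurable_cong_sets) (simp_all add: sets_\<mu>)

lemma continuous_on_ifs_map: "continuous_on A (ifs_map R b)"
  unfolding ifs_map_def[abs_def] by (intro continuous_intros) (use R_ge_2 in auto)

text \<open>Invariance is postulated for compactly supported test functions. Multiplying by cutoff
  functions that increase to \<open>1\<close> extends it to bounded continuous functions by dominated
  convergence on both sides.\<close>

lemma integral_transfer_op:
  assumes cont: "continuous_on UNIV u" and bdd: "\<And>x. \<bar>u x\<bar> \<le> C"
  shows "(LINT x|\<mu>. transfer_op R B u x) = (LINT x|\<mu>. u x)"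
proof -
  define cut where "cut n x = max 0 (min 1 (real n - \<bar>x\<bar>))" for n and x :: real
  have cut_cont: "continuous_on A (cut n)" for A n
    unfolding cut_def[abs_def] by (intro continuous_intros)
  have cut_bdd: "\<bar>cut n x\<bar> \<le> 1" for n x
    by (simp add: cut_def)
  have cut_lim: "(\<lambda>n. cut n x) \<longlonglongrightarrow> 1" for x
  proof (rule tendsto_eventually)
    obtain N :: nat where N: "\<bar>x\<bar> + 1 \<le> real N"
      using real_arch_simple by blast
    then have "cut n x = 1" if "N \<le> n" for n
      using that by (simp add: cut_def)
    then show "\<forall>\<^sub>F n in sequentially. cut n x = 1"
      by (auto simp: eventually_sequentially)
  qed
  have u_meas: "u \<in> borel_measurable borel"
    using cont by (rule borel_measurable_continuous_onI)
  have step: "(LINT x|\<mu>. u x * cut n x)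
      = (\<Sum>b\<in>B. LINT x|\<mu>. u (ifs_map R b x) * cut n (ifs_map R b x)) / real (card B)" for n
  proof -
    define f where "f x = complex_of_real (u x * cut n x)" for x
    have "{x. f x \<noteq> 0} \<subseteq> cball 0 (real n)"
      by (auto simp: f_def cut_def max_def min_def dist_real_def split: if_splits)
    then have "closure {x. f x \<noteq> 0} \<subseteq> cball 0 (real n)"
      by (rule closure_minimal) simp
    then have "compact (closure {x. f x \<noteq> 0})"
      by (meson bounded_cball bounded_subset closed_closure compact_eq_bounded_closed)
    moreover have "continuous_on UNIV f"
      unfolding f_def[abs_def] by (intro continuous_intros cont cut_cont)
    ultimately have "(LINT x|\<mu>. f x) = 1 / of_nat (card B) * (\<Sum>b\<in>B. LINT x|\<mu>. f (ifs_map R b x))"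
      using invariant unfolding ifs_invariant_measure_def by blast
    also have "\<dots> = complex_of_real ((\<Sum>b\<in>B. LINT x|\<mu>. u (ifs_map R b x) * cut n (ifs_map R b x)) / real (card B))"
      unfolding f_def integral_complex_of_real by simp
    finally show ?thesis
      unfolding f_def integral_complex_of_real of_real_eq_iff .
  qed
  have dct: "(\<lambda>n. LINT x|\<mu>. u (\<tau> x) * cut n (\<tau> x)) \<longlonglongrightarrow> (LINT x|\<mu>. u (\<tau> x))"
    if \<tau>: "continuous_on UNIV \<tau>" for \<tau>
  proof (rule integral_dominated_convergence[where w = "\<lambda>_. C"])
    have \<tau>_meas: "\<tau> \<in> borel_measurable borel"
      using \<tau> by (rule borel_measurable_continuous_onI)
    show "(\<lambda>x. u (\<tau> x)) \<in> borel_measurable \<mu>"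
      unfolding borel_measurable_\<mu> by (rule measurable_compose[OF \<tau>_meas u_meas])
    show "(\<lambda>x. u (\<tau> x) * cut n (\<tau> x)) \<in> borel_measurable \<mu>" for n
      unfolding borel_measurable_\<mu>
      by (intro borel_measurable_times measurable_compose[OF \<tau>_meas] u_meas
          borel_measurable_continuous_onI cut_cont)
    show "AE x in \<mu>. (\<lambda>n. u (\<tau> x) * cut n (\<tau> x)) \<longlonglongrightarrow> u (\<tau> x)"
      using tendsto_mult_left[OF cut_lim] by (intro AE_I2) simp
    show "AE x in \<mu>. norm (u (\<tau> x) * cut n (\<tau> x)) \<le> C" for n
    proof (rule AE_I2)
      fix x
      have "\<bar>u (\<tau> x)\<bar> * \<bar>cut n (\<tau> x)\<bar> \<le> C * 1"
        using bdd[of 0] by (intro mult_mono bdd cut_bdd) auto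
      then show "norm (u (\<tau> x) * cut n (\<tau> x)) \<le> C"
        by (simp add: abs_mult)
    qed
  qed simp
  have "(\<lambda>n. LINT x|\<mu>. u x * cut n x)
      \<longlonglongrightarrow> (\<Sum>b\<in>B. LINT x|\<mu>. u (ifs_map R b x)) / real (card B)"
    unfolding step using card_B_pos by (intro tendsto_intros dct continuous_on_ifs_map) auto
  then have "(LINT x|\<mu>. u x) = (\<Sum>b\<in>B. LINT x|\<mu>. u (ifs_map R b x)) / real (card B)"
    using dct[OF continuous_on_id] LIMSEQ_unique by blast
  also have "\<dots> = (LINT x|\<mu>. transfer_op R B u x)"
  proof -
    have "integrable \<mu> (\<lambda>x. u (ifs_map R b x))" for b
      using bdd unfolding borel_measurable_\<mu>
      by (intro integrable_const_bound[where B = C] AE_I2)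
         (auto simp: borel_measurable_\<mu> intro!: measurable_compose[OF borel_measurable_continuous_onI[OF continuous_on_ifs_map] u_meas])
    then show ?thesis
      by (simp add: transfer_op_def)
  qed
  finally show ?thesis ..
qed

lemma transfer_op_bounded:
  assumes "\<And>x. \<bar>u x\<bar> \<le> C"
  shows "\<bar>transfer_op R B u x\<bar> \<le> C"
proof -
  have "\<bar>\<Sum>b\<in>B. u (ifs_map R b x)\<bar> \<le> (\<Sum>b\<in>B. C)"
    by (intro order_trans[OF sum_abs] sum_mono assms)
  then show ?thesis
    using card_B_pos by (simp add: transfer_op_def field_simps)
qed

lemma transfer_op_lipschitz:
  assumes "\<And>x y. \<bar>u x - u y\<bar> \<le> K * \<bar>x - y\<bar>"
  shows "\<bar>transfer_op R B u x - transfer_op R B u y\<bar> \<le> K / of_int R * \<bar>x - y\<bar>"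
proof -
  have "\<bar>\<Sum>b\<in>B. u (ifs_map R b x) - u (ifs_map R b y)\<bar> \<le> (\<Sum>b\<in>B. K / of_int R * \<bar>x - y\<bar>)"
  proof (intro order_trans[OF sum_abs] sum_mono)
    fix b
    have "ifs_map R b x - ifs_map R b y = (x - y) / of_int R"
      by (simp add: ifs_map_def diff_divide_distrib add_divide_distrib)
    then show "\<bar>u (ifs_map R b x) - u (ifs_map R b y)\<bar> \<le> K / of_int R * \<bar>x - y\<bar>"
      using assms[of "ifs_map R b x" "ifs_map R b y"] R_ge_2 by (simp add: abs_divide)
  qed
  then show ?thesis
    using card_B_pos by (simp add: transfer_op_def sum_subtractf field_simps flip: diff_divide_distrib)
qed

lemma transfer_op_iterates_bounded:
  assumes "\<And>x. \<bar>u x\<bar> \<le> C"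
  shows "\<bar>(transfer_op R B ^^ n) u x\<bar> \<le> C"
  by (induction n arbitrary: x) (auto intro: assms transfer_op_bounded)

lemma transfer_op_iterates_lipschitz:
  assumes "\<And>x y. \<bar>u x - u y\<bar> \<le> K * \<bar>x - y\<bar>"
  shows "\<bar>(transfer_op R B ^^ n) u x - (transfer_op R B ^^ n) u y\<bar> \<le> K / of_int R ^ n * \<bar>x - y\<bar>"
proof (induction n arbitrary: x y)
  case (Suc n)
  show ?case
    using transfer_op_lipschitz[OF Suc] by (simp add: mult.commute)
qed (simp add: assms)

lemma (in -) lipschitz_imp_continuous_on:
  assumes "\<And>x y. \<bar>u x - u y\<bar> \<le> K * \<bar>x - y :: real\<bar>"
  shows "continuous_on A (u :: real \<Rightarrow> real)"
proof -
  have "0 \<le> K" using order_trans[OF abs_ge_zero assms[of 1 0]] by simp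
  then have "K-lipschitz_on A u"
    using assms by (auto intro!: lipschitz_onI simp: dist_real_def)
  then show ?thesis
    by (rule lipschitz_on_continuous_on)
qed

text \<open>The iterates \<open>v n\<close> of \<open>u\<close> have Lipschitz constants tending to \<open>0\<close>, but all have the same
  \<open>\<mu>\<close>-integral. So \<open>v n x\<close> differs from that integral by the average of \<open>v n x - v n y\<close> over \<open>y\<close>,
  which tends to \<open>0\<close> by dominated convergence.\<close>

lemma transfer_op_iterates_tendsto:
  assumes lip: "\<And>x y. \<bar>u x - u y\<bar> \<le> K * \<bar>x - y\<bar>" and bdd: "\<And>x. \<bar>u x\<bar> \<le> C"
  shows "(\<lambda>n. (transfer_op R B ^^ n) u x) \<longlonglongrightarrow> (LINT y|\<mu>. u y)"
proof -
  define v where "v n = (transfer_op R B ^^ n) u" for n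
  have v_lip: "\<bar>v n x - v n y\<bar> \<le> K / of_int R ^ n * \<bar>x - y\<bar>" for n x y
    unfolding v_def using lip by (rule transfer_op_iterates_lipschitz)
  have v_bdd: "\<bar>v n x\<bar> \<le> C" for n x
    unfolding v_def using bdd by (rule transfer_op_iterates_bounded)
  have v_cont: "continuous_on UNIV (v n)" for n
    using v_lip by (rule lipschitz_imp_continuous_on)
  have v_meas: "v n \<in> borel_measurable \<mu>" for n
    unfolding borel_measurable_\<mu> using v_cont by (rule borel_measurable_continuous_onI)
  have v_int: "(LINT y|\<mu>. v n y) = (LINT y|\<mu>. u y)" for n
  proof (induction n)
    case (Suc n)
    have "v (Suc n) = transfer_op R B (v n)" by (simp add: v_def)
    then show ?case
      using integral_transfer_op[OF v_cont v_bdd, of n] Suc by simp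
  qed (simp add: v_def)
  have "(\<lambda>n. LINT y|\<mu>. v n x - v n y) \<longlonglongrightarrow> (LINT y|\<mu>. 0)"
  proof (rule integral_dominated_convergence[where w = "\<lambda>_. 2 * C"])
    show "(\<lambda>y. v n x - v n y) \<in> borel_measurable \<mu>" for n
      using v_meas[of n] by measurable
    show "AE y in \<mu>. (\<lambda>n. v n x - v n y) \<longlonglongrightarrow> 0"
    proof (rule AE_I2)
      fix y
      have "(\<lambda>n. (K * \<bar>x - y\<bar>) * inverse (real_of_int R ^ n)) \<longlonglongrightarrow> (K * \<bar>x - y\<bar>) * 0"
        using R_ge_2 by (intro tendsto_mult_left LIMSEQ_inverse_realpow_zero) simp
      then have "(\<lambda>n. K / of_int R ^ n * \<bar>x - y\<bar>) \<longlonglongrightarrow> 0"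
        by (simp add: field_simps)
      then show "(\<lambda>n. v n x - v n y) \<longlonglongrightarrow> 0"
        by (rule Lim_null_comparison[rotated]) (use v_lip in \<open>simp only: real_norm_def eventually_True\<close>)
    qed
    show "AE y in \<mu>. norm (v n x - v n y) \<le> 2 * C" for n
    proof (rule AE_I2)
      fix y
      show "norm (v n x - v n y) \<le> 2 * C"
        using v_bdd[of n x] v_bdd[of n y] by (simp add: abs_le_iff)
    qed
  qed auto
  moreover have "(LINT y|\<mu>. v n x - v n y) = v n x - (LINT y|\<mu>. u y)" for n
  proof -
    have "integrable \<mu> (v n)"
      using v_bdd by (intro integrable_const_bound[where B = C] v_meas AE_I2) auto
    then show ?thesis
      using v_int prob_space by simp
  qed
  ultimately have "(\<lambda>n. v n x - (LINT y|\<mu>. u y)) \<longlonglongrightarrow> 0"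
    by simp
  then show ?thesis
    unfolding v_def by (rule LIM_zero_cancel)
qed

end

section \<open>Splitting the binary digits\<close>

text \<open>The binary digits of \<open>x\<close> in positions \<open>2 k + 1\<close>, with their weights
  \<open>2\<^sup>-\<^sup>2\<^sup>k\<^sup>-\<^sup>1 = 2 / 4\<^sup>k\<^sup>+\<^sup>1\<close>.\<close>

definition odd_digits :: "real \<Rightarrow> real" where
  "odd_digits x = (\<Sum>k. 2 * real_of_int (\<lfloor>2 * 4 ^ k * x\<rfloor> mod 2) / 4 ^ Suc k)"

text \<open>Defining the contribution of the even positions as a difference makes
  \<open>odd_digits x + even_digits x = x\<close> hold by construction, also at the dyadic rationals,
  which have two binary expansions.\<close>

definition even_digits :: "real \<Rightarrow> real" where
  "even_digits x = x - odd_digits x"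

lemma odd_digits_measurable [measurable]: "odd_digits \<in> borel_measurable borel"
  unfolding odd_digits_def[abs_def] by measurable

lemma even_digits_measurable [measurable]: "even_digits \<in> borel_measurable borel"
  unfolding even_digits_def[abs_def] by measurable

lemma summable_odd_digits: "summable (\<lambda>k. 2 * real_of_int (\<lfloor>2 * 4 ^ k * x\<rfloor> mod 2) / 4 ^ Suc k)"
proof (rule summable_comparison_test')
  show "summable (\<lambda>k. 2 * (1 / 4 :: real) ^ k)"
    by (intro summable_mult summable_geometric) simp
  fix k
  have "\<bar>real_of_int (\<lfloor>2 * 4 ^ k * x\<rfloor> mod 2)\<bar> \<le> 1"
    by linarith
  then show "norm (2 * real_of_int (\<lfloor>2 * 4 ^ k * x\<rfloor> mod 2) / 4 ^ Suc k) \<le> 2 * (1 / 4) ^ k"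
    by (simp add: abs_mult power_divide field_simps)
qed

text \<open>On \<open>[0, 1)\<close>, prefixing the base-4 digit \<open>2 a + c\<close> to \<open>x\<close> prefixes \<open>2 a\<close> to the odd part and
  \<open>c\<close> to the even part. The point \<open>x = 1\<close> is excluded because there \<open>c = 1\<close> would carry into
  the bit \<open>a\<close>.\<close>

lemma odd_digits_branch:
  assumes "0 \<le> x" "x < 1" "a \<in> {0, 1}" "c \<in> {0, 1}"
  shows "odd_digits ((x + of_int (2 * a + c)) / 4) = ifs_map 4 (2 * a) (odd_digits x)"
proof -
  let ?y = "(x + of_int (2 * a + c)) / 4"
  \<comment> \<open>The leading binary digit of \<open>?y\<close> is \<open>a\<close>, and all further odd positions are those of \<open>x\<close>, shifted.\<close>
  have "\<lfloor>2 * ?y\<rfloor> = a"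
    using assms by (intro floor_unique) auto
  moreover have "\<lfloor>2 * 4 ^ Suc k * ?y\<rfloor> mod 2 = \<lfloor>2 * 4 ^ k * x\<rfloor> mod 2" for k
  proof -
    have "2 * 4 ^ Suc k * ?y = 2 * 4 ^ k * x + of_int (2 * (4 ^ k * (2 * a + c)))"
      by (simp add: field_simps)
    then have "\<lfloor>2 * 4 ^ Suc k * ?y\<rfloor> = \<lfloor>2 * 4 ^ k * x\<rfloor> + 2 * (4 ^ k * (2 * a + c))"
      by (simp only: floor_add_int)
    then show ?thesis by simp
  qed
  ultimately have "odd_digits ?y = 2 * real_of_int (a mod 2) / 4
      + (\<Sum>k. 2 * real_of_int (\<lfloor>2 * 4 ^ k * x\<rfloor> mod 2) / 4 ^ Suc k / 4)"
    unfolding odd_digits_def using suminf_split_head[OF summable_odd_digits[of ?y]]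
    by (simp add: field_simps)
  also have "\<dots> = ifs_map 4 (2 * a) (odd_digits x)"
    unfolding suminf_divide[OF summable_odd_digits] odd_digits_def[symmetric]
    using assms(3) by (auto simp: ifs_map_def add_divide_distrib)
  finally show ?thesis .
qed

lemma even_digits_branch:
  assumes "0 \<le> x" "x < 1" "a \<in> {0, 1}" "c \<in> {0, 1}"
  shows "even_digits ((x + of_int (2 * a + c)) / 4) = ifs_map 4 c (even_digits x)"
  unfolding even_digits_def odd_digits_branch[OF assms] by (simp add: ifs_map_def field_simps)

text \<open>Lebesgue measure on \<open>[0, 1]\<close> is the invariant measure of the IFS with base 4 and all four
  digits, here written as \<open>2 a + c\<close>.\<close>

lemma integral_unit_lebesgue_branches:
  fixes \<phi> :: "real \<Rightarrow> real"
  assumes meas [measurable]: "\<phi> \<in> borel_measurable borel" and bdd: "\<And>x. \<bar>\<phi> x\<bar> \<le> C"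
  shows "(LINT x|unit_lebesgue. \<phi> x)
         = (\<Sum>a\<in>{0, 1}. \<Sum>c\<in>{0, 1}. LINT x|unit_lebesgue. \<phi> ((x + of_int (2 * a + c)) / 4)) / 4"
proof -
  \<comment> \<open>The half-open intervals of the four branches tile \<open>[0, 1)\<close>, hence \<open>[0, 1]\<close> up to a null set.\<close>
  have half_open: "(LINT x|unit_lebesgue. \<psi> x) = (LINT x|lborel. indicator {0..<1} x * \<psi> x)"
    if "\<psi> \<in> borel_measurable borel" for \<psi> :: "real \<Rightarrow> real"
  proof -
    note [measurable] = that
    have "(LINT x|unit_lebesgue. \<psi> x) = (LINT x|lborel. indicator {0..1} x * \<psi> x)"
      by (simp add: integral_restrict_space)
    also have "\<dots> = (LINT x|lborel. indicator {0..<1} x * \<psi> x)"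
    proof (rule integral_cong_AE)
      show "AE x in lborel. indicator {0..1} x * \<psi> x = indicator {0..<1} x * \<psi> x"
        using AE_lborel_singleton[of 1] by eventually_elim (auto simp: indicator_def)
    qed (simp_all add: that)
    finally show ?thesis .
  qed
  have branch: "(LINT x|lborel. indicator {of_int q / 4..<(of_int q + 1) / 4} x * \<phi> x)
      = (LINT x|unit_lebesgue. \<phi> ((x + of_int q) / 4)) / 4" for q :: int
  proof -
    have "(LINT x|lborel. indicator {of_int q / 4..<(of_int q + 1) / 4} x * \<phi> x)
        = \<bar>1 / 4\<bar> *\<^sub>R (LINT x|lborel. indicator {of_int q / 4..<(of_int q + 1) / 4} (of_int q / 4 + 1 / 4 * x)
             * \<phi> (of_int q / 4 + 1 / 4 * x))"
      by (rule lborel_integral_real_affine) simp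
    also have "\<dots> = (LINT x|lborel. indicator {0..<1} x * \<phi> ((x + of_int q) / 4)) / 4"
      by (auto intro!: Bochner_Integration.integral_cong simp: indicator_def field_simps)
    also have "\<dots> = (LINT x|unit_lebesgue. \<phi> ((x + of_int q) / 4)) / 4"
      by (subst half_open) auto
    finally show ?thesis .
  qed
  have int: "integrable lborel (\<lambda>x. indicator {of_int q / 4..<(of_int q + 1) / 4} x * \<phi> x)" for q :: int
  proof (rule Bochner_Integration.integrable_bound)
    show "integrable lborel (\<lambda>x::real. C * indicator {of_int q / 4..<(of_int q + 1) / 4} x)"
      by (intro integrable_mult_right integrable_real_indicator) auto
    show "AE x::real in lborel. norm (indicator {of_int q / 4..<(of_int q + 1) / 4} x * \<phi> x)
        \<le> norm (C * indicator {of_int q / 4..<(of_int q + 1) / 4} x)"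
      using bdd by (intro AE_I2) (auto simp: indicator_def intro: order_trans[OF _ abs_ge_self])
  qed (simp add: meas)
  have sum4: "(\<Sum>q\<in>{0,1,2,3::int}. h q) = h 0 + h 1 + h 2 + h 3" for h :: "int \<Rightarrow> real"
    by simp
  have "(LINT x|unit_lebesgue. \<phi> x) = (LINT x|lborel. (\<Sum>q\<in>{0,1,2,3::int}.
      indicator {of_int q / 4..<(of_int q + 1) / 4} x * \<phi> x))"
    unfolding half_open[OF meas] sum4
    by (rule Bochner_Integration.integral_cong) (auto simp: indicator_def)
  also have "\<dots> = (\<Sum>q\<in>{0,1,2,3::int}. (LINT x|unit_lebesgue. \<phi> ((x + of_int q) / 4)) / 4)"
    unfolding branch[symmetric] by (rule Bochner_Integration.integral_sum) (rule int)
  finally show ?thesis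
    by (simp add: add_divide_distrib)
qed

text \<open>By the branch rules, averaging over the four digits \<open>2 a + c\<close> factors into averaging \<open>u\<close> over
  \<open>a\<close> and \<open>v\<close> over \<open>c\<close>.\<close>

lemma integral_transfer_digits:
  assumes u: "continuous_on UNIV u" "\<And>x. \<bar>u x\<bar> \<le> C" and v: "continuous_on UNIV v" "\<And>x. \<bar>v x\<bar> \<le> D"
  shows "(LINT x|unit_lebesgue. u (odd_digits x) * v (even_digits x))
         = (LINT x|unit_lebesgue. transfer_op 4 {0, 2} u (odd_digits x) * transfer_op 4 {0, 1} v (even_digits x))"
proof -
  have [measurable]: "u \<in> borel_measurable borel" "v \<in> borel_measurable borel"
    using u(1) v(1) by (auto intro: borel_measurable_continuous_onI)
  have [measurable]: "ifs_map 4 b \<in> borel_measurable borel" for b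
    unfolding ifs_map_def[abs_def] by measurable
  let ?w = "\<lambda>a c x. u (ifs_map 4 (2 * a) (odd_digits x)) * v (ifs_map 4 c (even_digits x))"
  have bdd: "\<bar>u s * v t\<bar> \<le> C * D" for s t
    using u(2)[of s] v(2)[of t] by (auto simp: abs_mult intro!: mult_mono)
  have int: "integrable unit_lebesgue (?w a c)" for a c
    using bdd by (intro unit_lebesgue.integrable_const_bound[where B = "C * D"] AE_I2
        borel_measurable_unit_lebesgue) auto
  have "(LINT x|unit_lebesgue. u (odd_digits x) * v (even_digits x))
      = (\<Sum>a\<in>{0, 1}. \<Sum>c\<in>{0, 1}. LINT x|unit_lebesgue.
          u (odd_digits ((x + of_int (2 * a + c)) / 4)) * v (even_digits ((x + of_int (2 * a + c)) / 4))) / 4"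
    by (rule integral_unit_lebesgue_branches[OF _ bdd]) measurable
  also have "\<dots> = (\<Sum>a\<in>{0, 1}. \<Sum>c\<in>{0, 1}. LINT x|unit_lebesgue. ?w a c x) / 4"
  proof (intro arg_cong2[where f = "(/)"] sum.cong refl integral_cong_AE)
    fix a c :: int assume ac: "a \<in> {0, 1}" "c \<in> {0, 1}"
    show "AE x in unit_lebesgue. u (odd_digits ((x + of_int (2 * a + c)) / 4))
        * v (even_digits ((x + of_int (2 * a + c)) / 4)) = ?w a c x"
      using AE_unit_lebesgue_neq_1
      by eventually_elim (simp only: odd_digits_branch[OF _ _ ac] even_digits_branch[OF _ _ ac])
  qed (auto intro!: borel_measurable_unit_lebesgue)
  also have "\<dots> = (LINT x|unit_lebesgue. (\<Sum>a\<in>{0, 1}. \<Sum>c\<in>{0, 1}. ?w a c x) / 4)"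
    using int by (simp del: sum.insert)
  also have "\<dots> = (LINT x|unit_lebesgue. transfer_op 4 {0, 2} u (odd_digits x)
      * transfer_op 4 {0, 1} v (even_digits x))"
    by (rule Bochner_Integration.integral_cong) (simp_all add: transfer_op_def algebra_simps)
  finally show ?thesis .
qed

section \<open>Lebesgue measure on the unit interval is the convolution of the two invariant measures\<close>

text \<open>Lipschitz approximations of the indicators of half-lines.\<close>

definition ramp :: "nat \<Rightarrow> real \<Rightarrow> real \<Rightarrow> real" where
  "ramp n a x = max 0 (min 1 (1 - real n * (x - a)))"

lemma ramp_bounded: "\<bar>ramp n a x\<bar> \<le> 1"
  by (simp add: ramp_def)

lemma ramp_lipschitz: "\<bar>ramp n a x - ramp n a y\<bar> \<le> real n * \<bar>x - y\<bar>"
proof -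
  have "\<bar>ramp n a x - ramp n a y\<bar> \<le> \<bar>(1 - real n * (x - a)) - (1 - real n * (y - a))\<bar>"
    unfolding ramp_def by (auto simp: max_def min_def abs_if)
  also have "\<dots> = \<bar>real n * (y - x)\<bar>"
    by (simp add: algebra_simps)
  finally show ?thesis
    by (simp add: abs_mult abs_minus_commute)
qed

lemma ramp_tendsto_indicator: "(\<lambda>n. ramp n a x) \<longlonglongrightarrow> indicator {..a} x"
proof (cases "x \<le> a")
  case True
  then have "ramp n a x = 1" for n
    by (simp add: ramp_def mult_nonneg_nonpos)
  then show ?thesis
    using True by simp
next
  case False
  then have pos: "0 < x - a" by simp
  obtain N :: nat where N: "1 < real N * (x - a)"
    using reals_Archimedean3[OF pos] by blast
  have "ramp n a x = 0" if "N \<le> n" for n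
  proof -
    have "real N * (x - a) \<le> real n * (x - a)"
      using that pos by (intro mult_right_mono) auto
    then show ?thesis
      using N by (simp add: ramp_def)
  qed
  then have "\<forall>\<^sub>F n in sequentially. ramp n a x = 0"
    by (auto simp: eventually_sequentially)
  then show ?thesis
    using False by (simp add: tendsto_eventually)
qed

locale ifs_pair =
  \<mu>: ifs_measure 4 "{0, 2}" \<mu> + \<mu>': ifs_measure 4 "{0, 1}" \<mu>' for \<mu> \<mu>' :: "real measure"
begin

text \<open>The left-hand side is unchanged when \<open>u\<close> and \<open>v\<close> are replaced by their \<open>n\<close>-th iterates under
  the transfer operators; these converge to the constants on the right.\<close>

lemma integral_digits_lipschitz:
  assumes u: "\<And>x y. \<bar>u x - u y\<bar> \<le> K * \<bar>x - y\<bar>" "\<And>x. \<bar>u x\<bar> \<le> C"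
    and v: "\<And>x y. \<bar>v x - v y\<bar> \<le> L * \<bar>x - y\<bar>" "\<And>x. \<bar>v x\<bar> \<le> D"
  shows "(LINT x|unit_lebesgue. u (odd_digits x) * v (even_digits x)) = (LINT x|\<mu>. u x) * (LINT x|\<mu>'. v x)"
proof -
  define u' where "u' n = (transfer_op 4 {0, 2} ^^ n) u" for n
  define v' where "v' n = (transfer_op 4 {0, 1} ^^ n) v" for n
  have u'_bdd: "\<bar>u' n x\<bar> \<le> C" for n x
    unfolding u'_def using u(2) by (rule \<mu>.transfer_op_iterates_bounded)
  have v'_bdd: "\<bar>v' n x\<bar> \<le> D" for n x
    unfolding v'_def using v(2) by (rule \<mu>'.transfer_op_iterates_bounded)
  have u'_cont: "continuous_on UNIV (u' n)" for n
    unfolding u'_def by (rule lipschitz_imp_continuous_on, rule \<mu>.transfer_op_iterates_lipschitz[OF u(1)])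
  have v'_cont: "continuous_on UNIV (v' n)" for n
    unfolding v'_def by (rule lipschitz_imp_continuous_on, rule \<mu>'.transfer_op_iterates_lipschitz[OF v(1)])
  have [measurable]: "u' n \<in> borel_measurable borel" "v' n \<in> borel_measurable borel" for n
    using u'_cont v'_cont by (auto intro: borel_measurable_continuous_onI)
  let ?I = "\<lambda>n. LINT x|unit_lebesgue. u' n (odd_digits x) * v' n (even_digits x)"
  have const: "?I n = (LINT x|unit_lebesgue. u (odd_digits x) * v (even_digits x))" for n
  proof (induction n)
    case (Suc n)
    have "?I (Suc n) = ?I n"
      using integral_transfer_digits[OF u'_cont[of n] u'_bdd v'_cont[of n] v'_bdd]
      by (simp add: u'_def v'_def)
    then show ?case
      using Suc by simp
  qed (simp add: u'_def v'_def)
  have "?I \<longlonglongrightarrow> (LINT x|unit_lebesgue. (LINT y|\<mu>. u y) * (LINT y|\<mu>'. v y))"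
  proof (rule integral_dominated_convergence[where w = "\<lambda>_. C * D"])
    show "(\<lambda>x. u' n (odd_digits x) * v' n (even_digits x)) \<in> borel_measurable unit_lebesgue" for n
      by (rule borel_measurable_unit_lebesgue) measurable
    show "AE x in unit_lebesgue. (\<lambda>n. u' n (odd_digits x) * v' n (even_digits x))
        \<longlonglongrightarrow> (LINT y|\<mu>. u y) * (LINT y|\<mu>'. v y)"
      unfolding u'_def v'_def
      by (intro AE_I2 tendsto_mult \<mu>.transfer_op_iterates_tendsto[OF u] \<mu>'.transfer_op_iterates_tendsto[OF v])
    show "AE x in unit_lebesgue. norm (u' n (odd_digits x) * v' n (even_digits x)) \<le> C * D" for n
    proof (rule AE_I2)
      fix x
      have "\<bar>u' n (odd_digits x)\<bar> * \<bar>v' n (even_digits x)\<bar> \<le> C * D"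
        using order_trans[OF abs_ge_zero u(2)] by (intro mult_mono u'_bdd v'_bdd) auto
      then show "norm (u' n (odd_digits x) * v' n (even_digits x)) \<le> C * D"
        by (simp add: abs_mult)
    qed
  qed auto
  then have "?I \<longlonglongrightarrow> (LINT y|\<mu>. u y) * (LINT y|\<mu>'. v y)"
    using unit_lebesgue.prob_space by simp
  then show ?thesis
    unfolding const using LIMSEQ_unique tendsto_const by blast
qed

lemma measure_digits_atMost:
  "measure unit_lebesgue {x \<in> {0..1}. odd_digits x \<le> a \<and> even_digits x \<le> b} = measure \<mu> {..a} * measure \<mu>' {..b}"
proof -
  have ramp_meas [measurable]: "ramp n c \<in> borel_measurable borel" for n c
    unfolding ramp_def[abs_def] by measurable
  have marginal: "(\<lambda>n. LINT x|M. ramp n c x) \<longlonglongrightarrow> measure M {..c}"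
    if "ifs_measure R B M" for M R B c
  proof -
    interpret M: ifs_measure R B M by fact
    have "(\<lambda>n. LINT x|M. ramp n c x) \<longlonglongrightarrow> (LINT x|M. indicator {..c} x)"
      by (rule integral_dominated_convergence[where w = "\<lambda>_. 1"])
         (auto simp: M.borel_measurable_\<mu> ramp_tendsto_indicator ramp_bounded intro!: AE_I2)
    then show ?thesis
      by (simp add: M.sets_\<mu>)
  qed
  have "(\<lambda>n. LINT x|unit_lebesgue. ramp n a (odd_digits x) * ramp n b (even_digits x))
      \<longlonglongrightarrow> (LINT x|unit_lebesgue. indicator {x \<in> {0..1}. odd_digits x \<le> a \<and> even_digits x \<le> b} x)"
  proof (rule integral_dominated_convergence[where w = "\<lambda>_. 1"])
    show "(\<lambda>x. ramp n a (odd_digits x) * ramp n b (even_digits x)) \<in> borel_measurable unit_lebesgue" for n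
      by (rule borel_measurable_unit_lebesgue) measurable
    show "(\<lambda>x. indicator {x \<in> {0..1}. odd_digits x \<le> a \<and> even_digits x \<le> b} x :: real) \<in> borel_measurable unit_lebesgue"
      by (rule borel_measurable_unit_lebesgue) measurable
    show "AE x in unit_lebesgue. (\<lambda>n. ramp n a (odd_digits x) * ramp n b (even_digits x))
        \<longlonglongrightarrow> indicator {x \<in> {0..1}. odd_digits x \<le> a \<and> even_digits x \<le> b} x"
    proof (rule AE_I2)
      fix x assume "x \<in> space unit_lebesgue"
      then have "indicator {x \<in> {0..1}. odd_digits x \<le> a \<and> even_digits x \<le> b} x
          = (indicator {..a} (odd_digits x) * indicator {..b} (even_digits x) :: real)"
        by (auto simp: indicator_def space_restrict_space)
      then show "(\<lambda>n. ramp n a (odd_digits x) * ramp n b (even_digits x))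
          \<longlonglongrightarrow> indicator {x \<in> {0..1}. odd_digits x \<le> a \<and> even_digits x \<le> b} x"
        by (simp only: tendsto_mult[OF ramp_tendsto_indicator ramp_tendsto_indicator])
    qed
    show "AE x in unit_lebesgue. norm (ramp n a (odd_digits x) * ramp n b (even_digits x)) \<le> 1" for n
      by (intro AE_I2) (auto simp: abs_mult ramp_bounded intro: mult_le_one)
  qed auto
  moreover have "(\<lambda>n. LINT x|unit_lebesgue. ramp n a (odd_digits x) * ramp n b (even_digits x))
      \<longlonglongrightarrow> measure \<mu> {..a} * measure \<mu>' {..b}"
    unfolding integral_digits_lipschitz[OF ramp_lipschitz ramp_bounded ramp_lipschitz ramp_bounded]
    by (intro tendsto_mult marginal[OF \<mu>.ifs_measure_axioms] marginal[OF \<mu>'.ifs_measure_axioms])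
  ultimately have "(LINT x|unit_lebesgue. indicator {x \<in> {0..1}. odd_digits x \<le> a \<and> even_digits x \<le> b} x)
      = measure \<mu> {..a} * measure \<mu>' {..b}"
    by (rule LIMSEQ_unique)
  moreover have "{x \<in> {0..1}. odd_digits x \<le> a \<and> even_digits x \<le> b} \<inter> {0..1}
      = {x \<in> {0..1}. odd_digits x \<le> a \<and> even_digits x \<le> b}"
    by auto
  ultimately show ?thesis
    by (simp add: space_restrict_space)
qed

lemma digits_measurable:
  "odd_digits \<in> borel_measurable unit_lebesgue" "even_digits \<in> borel_measurable unit_lebesgue"
  by (simp_all add: borel_measurable_unit_lebesgue)

text \<open>The quadrants \<open>{..a} \<times> {..b}\<close> are the sets \<open>{..(a, b)}\<close> of the product order and generate the
  Borel sets of the plane, so agreement on them determines the joint law.\<close>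

lemma distr_digits:
  "distr unit_lebesgue (borel \<Otimes>\<^sub>M borel) (\<lambda>x. (odd_digits x, even_digits x)) = \<mu> \<Otimes>\<^sub>M \<mu>'"
proof -
  note [measurable] = digits_measurable
  interpret \<mu>\<mu>': pair_prob_space \<mu> \<mu>' ..
  have sets_prod: "sets (\<mu> \<Otimes>\<^sub>M \<mu>') = sets (borel :: (real \<times> real) measure)"
    using sets_pair_measure_cong[OF \<mu>.sets_\<mu> \<mu>'.sets_\<mu>] by (simp only: borel_prod)
  have rect: "{..(a, b)} = {..a} \<times> {..b}" for a b :: real
    by auto
  interpret D: prob_space "distr unit_lebesgue (borel \<Otimes>\<^sub>M borel) (\<lambda>x. (odd_digits x, even_digits x))"
    by (rule unit_lebesgue.prob_space_distr) measurable
  show ?thesis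
  proof (rule measure_eqI_generator_eq)
    let ?E = "range (\<lambda>p :: real \<times> real. {..p})"
    show "Int_stable ?E"
    proof (rule Int_stableI, safe)
      fix p q :: "real \<times> real"
      show "{..p} \<inter> {..q} \<in> ?E"
        by (intro range_eqI[of _ _ "inf p q"]) auto
    qed
    show "?E \<subseteq> Pow UNIV" by simp
    show "sets (distr unit_lebesgue (borel \<Otimes>\<^sub>M borel) (\<lambda>x. (odd_digits x, even_digits x))) = sigma_sets UNIV ?E"
      by (simp add: borel_prod) (simp add: borel_eq_atMost)
    show "sets (\<mu> \<Otimes>\<^sub>M \<mu>') = sigma_sets UNIV ?E"
      by (simp add: sets_prod) (simp add: borel_eq_atMost)
    show "range (\<lambda>n::nat. {..(real n, real n)}) \<subseteq> ?E" by auto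
    show "(\<Union>n::nat. {..(real n, real n)}) = UNIV"
    proof (rule UNIV_eq_I[symmetric])
      fix p :: "real \<times> real"
      obtain n :: nat where "max (fst p) (snd p) \<le> real n"
        using real_arch_simple by blast
      then show "p \<in> (\<Union>n::nat. {..(real n, real n)})"
        by (cases p) auto
    qed
    show "emeasure (distr unit_lebesgue (borel \<Otimes>\<^sub>M borel) (\<lambda>x. (odd_digits x, even_digits x)))
        {..(real n, real n)} \<noteq> \<infinity>" for n
      by simp
    fix X assume "X \<in> ?E"
    then obtain a b where X: "X = {..a} \<times> {..b}"
      by (auto simp: rect)
    have X_sets: "X \<in> sets (borel \<Otimes>\<^sub>M borel)"
      unfolding X by (intro pair_measureI) auto
    have "emeasure (distr unit_lebesgue (borel \<Otimes>\<^sub>M borel) (\<lambda>x. (odd_digits x, even_digits x))) X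
        = emeasure unit_lebesgue {x \<in> {0..1}. odd_digits x \<le> a \<and> even_digits x \<le> b}"
      by (subst emeasure_distr[OF _ X_sets])
         (auto simp: X space_restrict_space intro!: arg_cong[where f = "emeasure unit_lebesgue"])
    also have "\<dots> = emeasure \<mu> {..a} * emeasure \<mu>' {..b}"
      unfolding unit_lebesgue.emeasure_eq_measure \<mu>.emeasure_eq_measure \<mu>'.emeasure_eq_measure
        measure_digits_atMost by (simp add: ennreal_mult)
    also have "\<dots> = emeasure (\<mu> \<Otimes>\<^sub>M \<mu>') X"
      unfolding X by (rule \<mu>'.emeasure_pair_measure_Times[symmetric]) (simp_all add: \<mu>.sets_\<mu> \<mu>'.sets_\<mu>)
    finally show "emeasure (distr unit_lebesgue (borel \<Otimes>\<^sub>M borel) (\<lambda>x. (odd_digits x, even_digits x))) X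
        = emeasure (\<mu> \<Otimes>\<^sub>M \<mu>') X" .
  qed
qed

lemma distr_odd_digits: "distr unit_lebesgue borel odd_digits = \<mu>"
proof -
  note [measurable] = digits_measurable
  have "distr unit_lebesgue borel odd_digits = distr unit_lebesgue \<mu> odd_digits"
    by (rule distr_cong) (simp_all add: \<mu>.sets_\<mu>)
  also have "\<dots> = distr (\<mu> \<Otimes>\<^sub>M \<mu>') \<mu> fst"
    unfolding distr_digits[symmetric]
    by (subst distr_distr) (auto simp: comp_def \<mu>.sets_\<mu> cong: measurable_cong_sets)
  also have "\<dots> = \<mu>"
    by (rule \<mu>'.distr_pair_fst)
  finally show ?thesis .
qed

lemma distr_even_digits: "distr unit_lebesgue borel even_digits = \<mu>'"
proof -
  note [measurable] = digits_measurable
  interpret \<mu>\<mu>': pair_prob_space \<mu> \<mu>' ..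
  have "emeasure (distr unit_lebesgue borel even_digits) A = emeasure \<mu>' A" if A: "A \<in> sets borel" for A
  proof -
    have "emeasure (distr unit_lebesgue borel even_digits) A
        = emeasure (distr unit_lebesgue (borel \<Otimes>\<^sub>M borel) (\<lambda>x. (odd_digits x, even_digits x))) (UNIV \<times> A)"
      using A by (simp add: emeasure_distr) (auto intro!: arg_cong[where f = "emeasure unit_lebesgue"])
    also have "\<dots> = emeasure \<mu> UNIV * emeasure \<mu>' A"
      unfolding distr_digits using A
      by (intro \<mu>'.emeasure_pair_measure_Times) (simp_all add: \<mu>.sets_\<mu> \<mu>'.sets_\<mu>)
    finally show ?thesis
      using \<mu>.emeasure_space_1 by simp
  qed
  then show ?thesis
    by (intro measure_eqI) (simp_all add: \<mu>'.sets_\<mu>)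
qed

lemma indep_digits: "unit_lebesgue.indep_var borel odd_digits borel even_digits"
  unfolding unit_lebesgue.indep_var_distribution_eq distr_odd_digits distr_even_digits
  using digits_measurable distr_digits by simp

section \<open>The isometric embedding of the fractal Hilbert space\<close>

lemma L2_comp_odd_digits:
  assumes f: "f \<in> L2 \<mu>"
  shows "(\<lambda>x. f (odd_digits x)) \<in> L2 unit_lebesgue"
    and "(LINT x|unit_lebesgue. (cmod (f (odd_digits x)))\<^sup>2) = (LINT x|\<mu>. (cmod (f x))\<^sup>2)"
proof -
  note [measurable] = digits_measurable
  have f_meas [measurable]: "f \<in> borel_measurable borel"
    using L2_measurable[OF f] by (simp add: \<mu>.borel_measurable_\<mu>)
  have "integrable (distr unit_lebesgue borel odd_digits) (\<lambda>x. (cmod (f x))\<^sup>2)"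
    unfolding distr_odd_digits by (rule L2_integrable_power2[OF f])
  then show "(\<lambda>x. f (odd_digits x)) \<in> L2 unit_lebesgue"
    unfolding L2_def by (subst (asm) integrable_distr_eq) auto
  have "(LINT x|\<mu>. (cmod (f x))\<^sup>2) = (LINT x|distr unit_lebesgue borel odd_digits. (cmod (f x))\<^sup>2)"
    by (simp only: distr_odd_digits)
  also have "\<dots> = (LINT x|unit_lebesgue. (cmod (f (odd_digits x)))\<^sup>2)"
    by (rule integral_distr) auto
  finally show "(LINT x|unit_lebesgue. (cmod (f (odd_digits x)))\<^sup>2) = (LINT x|\<mu>. (cmod (f x))\<^sup>2)" ..
qed

text \<open>Since \<open>x = odd_digits x + even_digits x\<close>, the integrand splits into a factor depending on the
  odd digits and one depending on the even digits, which are independent with laws \<open>\<mu>\<close> and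
  \<open>\<mu>'\<close>.\<close>

lemma fourier_fun_comp_odd_digits:
  assumes f: "f \<in> L2 \<mu>"
  shows "fourier_fun unit_lebesgue (\<lambda>x. f (odd_digits x)) t = fourier_fun \<mu> f t * fourier_measure \<mu>' t"
proof -
  note [measurable] = digits_measurable
  have f_meas [measurable]: "f \<in> borel_measurable borel"
    using L2_measurable[OF f] by (simp add: \<mu>.borel_measurable_\<mu>)
  have e_meas [measurable]: "expo s \<in> borel_measurable borel" for s
    by (intro borel_measurable_continuous_onI continuous_on_expo)
  let ?X = "\<lambda>x. f (odd_digits x) * expo (- t) (odd_digits x)" and ?Y = "\<lambda>x. expo (- t) (even_digits x)"
  have "unit_lebesgue.indep_var borel ((\<lambda>y. f y * expo (- t) y) \<circ> odd_digits) borel (expo (- t) \<circ> even_digits)"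
    by (rule unit_lebesgue.indep_var_compose[OF indep_digits]) measurable
  then have indep: "unit_lebesgue.indep_var borel ?X borel ?Y"
    by (simp add: comp_def)
  have "expo (- t) \<circ> odd_digits \<in> borel_measurable unit_lebesgue"
    by measurable
  then have X: "integrable unit_lebesgue ?X"
    using unit_lebesgue.L2_integrable[OF L2_bounded_mult[OF L2_comp_odd_digits(1)[OF f],
          where g = "expo (- t) \<circ> odd_digits" and c = 1]]
    by (simp add: mult.commute)
  have Y: "integrable unit_lebesgue ?Y"
    by (rule unit_lebesgue.integrable_const_bound[where B = 1]) auto
  have split: "expo (- t) x = expo (- t) (odd_digits x) * expo (- t) (even_digits x)" for x
    unfolding expo_add_right[symmetric] by (simp add: even_digits_def)
  have "fourier_fun unit_lebesgue (\<lambda>x. f (odd_digits x)) t = (LINT x|unit_lebesgue. ?X x * ?Y x)"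
    unfolding fourier_fun_def by (subst split) (simp only: mult.assoc)
  also have "\<dots> = (LINT x|unit_lebesgue. ?X x) * (LINT x|unit_lebesgue. ?Y x)"
    by (rule unit_lebesgue.indep_var_lebesgue_integral[OF indep X Y])
  also have "(LINT x|unit_lebesgue. ?X x)
      = (LINT y|distr unit_lebesgue borel odd_digits. f y * expo (- t) y)"
    by (rule integral_distr[symmetric]) measurable
  also have "(LINT x|unit_lebesgue. ?Y x) = (LINT y|distr unit_lebesgue borel even_digits. expo (- t) y)"
    by (rule integral_distr[symmetric]) measurable
  finally show ?thesis
    by (simp add: distr_odd_digits distr_even_digits fourier_fun_def fourier_measure_def)
qed

text \<open>Composition with \<open>odd_digits\<close> preserves norms and turns the weighted coefficients in
  \<open>L\<^sup>2(\<mu>)\<close> into coefficients of equal modulus in \<open>L\<^sup>2[0, 1]\<close>, so every frame inequality is inherited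
  with the same bounds.\<close>

lemma L2_frame_transfer:
  assumes frame: "L2_frame unit_lebesgue (\<lambda>n. expo (l n)) A B"
  shows "L2_frame \<mu> (\<lambda>n x. complex_of_real (cmod (fourier_measure \<mu>' (l n))) * expo (l n) x) A B"
proof -
  have coeff: "cmod (L2_inner \<mu> v (\<lambda>x. complex_of_real (cmod (fourier_measure \<mu>' t)) * expo t x))
      = cmod (L2_inner unit_lebesgue (\<lambda>x. v (odd_digits x)) (expo t))" if "v \<in> L2 \<mu>" for v t
  proof -
    have "L2_inner unit_lebesgue (\<lambda>x. v (odd_digits x)) (expo t) = fourier_fun \<mu> v t * fourier_measure \<mu>' t"
      using L2_inner_expo[of unit_lebesgue "\<lambda>x. v (odd_digits x)" 1 t]
      by (simp add: fourier_fun_comp_odd_digits[OF that])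
    then show ?thesis
      by (simp add: L2_inner_expo norm_mult)
  qed
  have norm: "(L2_norm unit_lebesgue (\<lambda>x. v (odd_digits x)))\<^sup>2 = (L2_norm \<mu> v)\<^sup>2" if "v \<in> L2 \<mu>" for v
    using L2_comp_odd_digits(2)[OF that] by (simp add: L2_norm_power2)
  have "(\<lambda>x. complex_of_real (cmod (fourier_measure \<mu>' t)) * expo t x) \<in> L2 \<mu>" for t
    by (rule \<mu>.L2_bounded[where c = "cmod (fourier_measure \<mu>' t)"])
       (auto simp: \<mu>.borel_measurable_\<mu> norm_mult)
  moreover have "(\<lambda>n. (cmod (L2_inner unit_lebesgue (\<lambda>x. v (odd_digits x)) (expo (l n))))\<^sup>2) summable_on UNIV
      \<and> A * (L2_norm \<mu> v)\<^sup>2 \<le> (\<Sum>\<^sub>\<infinity>n. (cmod (L2_inner unit_lebesgue (\<lambda>x. v (odd_digits x)) (expo (l n))))\<^sup>2)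
      \<and> (\<Sum>\<^sub>\<infinity>n. (cmod (L2_inner unit_lebesgue (\<lambda>x. v (odd_digits x)) (expo (l n))))\<^sup>2) \<le> B * (L2_norm \<mu> v)\<^sup>2"
    if "v \<in> L2 \<mu>" for v
    using frame L2_comp_odd_digits(1)[OF that] unfolding L2_frame_def norm[OF that, symmetric] by blast
  ultimately show ?thesis
    using frame unfolding L2_frame_def by (auto simp: coeff)
qed

lemma borel_measurable_fourier_fun_\<mu>:
  assumes "f \<in> L2 \<mu>"
  shows "fourier_fun \<mu> f \<in> borel_measurable borel"
  by (intro borel_measurable_fourier_fun L2_measurable[OF assms] \<mu>.sigma_finite_measure_axioms)
     (simp add: \<mu>.borel_measurable_\<mu>)

lemma borel_measurable_fourier_measure_\<mu>': "fourier_measure \<mu>' \<in> borel_measurable borel"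
proof -
  have "fourier_measure \<mu>' = fourier_fun \<mu>' (\<lambda>_. 1)"
    by (simp add: fourier_measure_def[abs_def] fourier_fun_def[abs_def])
  then show ?thesis
    using borel_measurable_fourier_fun[of \<mu>' "\<lambda>_. 1"] \<mu>'.sigma_finite_measure_axioms
    by (simp add: \<mu>'.borel_measurable_\<mu>)
qed

end

text \<open>Working with the nonnegative integral settles square integrability and the norm identity at
  once.\<close>

lemma plancherel_measureI:
  assumes "sets \<nu> = sets borel"
    and meas: "\<And>f. f \<in> L2 \<mu> \<Longrightarrow> fourier_fun \<mu> f \<in> borel_measurable borel"
    and eq: "\<And>f. f \<in> L2 \<mu> \<Longrightarrow>
      (\<integral>\<^sup>+ t. ennreal ((cmod (fourier_fun \<mu> f t))\<^sup>2) \<partial>\<nu>) = ennreal (LINT x|\<mu>. (cmod (f x))\<^sup>2)"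
  shows "plancherel_measure \<nu> \<mu>"
  unfolding plancherel_measure_def
proof (intro conjI ballI)
  fix f assume f: "f \<in> L2 \<mu>"
  have meas': "fourier_fun \<mu> f \<in> borel_measurable \<nu>"
    using meas[OF f] measurable_cong_sets[OF assms(1) refl] by blast
  have "has_bochner_integral \<nu> (\<lambda>t. (cmod (fourier_fun \<mu> f t))\<^sup>2) (LINT x|\<mu>. (cmod (f x))\<^sup>2)"
    using meas' eq[OF f] by (intro has_bochner_integral_nn_integral) auto
  then show "fourier_fun \<mu> f \<in> L2 \<nu>" "L2_norm \<nu> (fourier_fun \<mu> f) = L2_norm \<mu> f"
    using meas' by (auto simp: L2_def L2_norm_def has_bochner_integral_iff)
qed fact

text \<open>In this form, integrals against the atomic measure become sums over the index set.\<close>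

lemma sum_measure_scaled_Dirac:
  assumes w: "\<And>n :: 'i :: countable. 0 \<le> w n"
  shows "sum_measure (\<lambda>n. scale_measure (ennreal (w n)) (return borel (p n)))
         = distr (density (count_space UNIV) (\<lambda>n. ennreal (w n))) borel p"
proof (rule measure_eqI)
  fix E assume "E \<in> sets (sum_measure (\<lambda>n. scale_measure (ennreal (w n)) (return borel (p n))))"
  then have E: "E \<in> sets borel" by simp
  then have "emeasure (sum_measure (\<lambda>n. scale_measure (ennreal (w n)) (return borel (p n)))) E
      = (\<integral>\<^sup>+ n. ennreal (w n) * indicator E (p n) \<partial>count_space UNIV)"
    by (subst emeasure_sum_measure) auto
  also have "\<dots> = emeasure (distr (density (count_space UNIV) (\<lambda>n. ennreal (w n))) borel p) E"
    using E by (simp add: emeasure_distr emeasure_density indicator_vimage vimage_def)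
       (simp add: indicator_def)
  finally show "emeasure (sum_measure (\<lambda>n. scale_measure (ennreal (w n)) (return borel (p n)))) E
      = emeasure (distr (density (count_space UNIV) (\<lambda>n. ennreal (w n))) borel p) E" .
qed simp

theorem corollary4p7:
  fixes \<mu> \<mu>' :: "real measure"
  assumes "ifs_invariant_measure 4 {0, 2} \<mu>"
    and "ifs_invariant_measure 4 {0, 1} \<mu>'"
  shows "plancherel_measure (density lborel (\<lambda>x. ennreal ((cmod (fourier_measure \<mu>' x))\<^sup>2))) \<mu> \<and>
         plancherel_measure
           (sum_measure (\<lambda>n::int. scale_measure (ennreal ((cmod (fourier_measure \<mu>' (of_int n)))\<^sup>2))
                                               (return borel (of_int n)))) \<mu> \<and>
         L2_parseval_frame \<mu>
           (\<lambda>(n::int) x. complex_of_real (cmod (fourier_measure \<mu>' (of_int n))) * expo (of_int n) x) \<and>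
         (\<forall>(l :: 'i::countable \<Rightarrow> real) A B.
            L2_frame (restrict_space lborel {0..1}) (\<lambda>n. expo (l n)) A B \<longrightarrow>
            L2_frame \<mu> (\<lambda>n x. complex_of_real (cmod (fourier_measure \<mu>' (l n))) * expo (l n) x) A B)"
proof -
  interpret ifs_pair \<mu> \<mu>'
    using assms by unfold_locales auto
  note [measurable] = borel_measurable_fourier_measure_\<mu>' borel_measurable_fourier_fun_\<mu>
  have coeff: "ennreal ((cmod (fourier_measure \<mu>' t))\<^sup>2) * ennreal ((cmod (fourier_fun \<mu> f t))\<^sup>2)
      = ennreal ((cmod (fourier_fun unit_lebesgue (\<lambda>x. f (odd_digits x)) t))\<^sup>2)" if "f \<in> L2 \<mu>" for f t
    by (simp add: fourier_fun_comp_odd_digits[OF that] norm_mult power_mult_distrib mult.commute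
        flip: ennreal_mult)
  have "plancherel_measure (density lborel (\<lambda>x. ennreal ((cmod (fourier_measure \<mu>' x))\<^sup>2))) \<mu>"
  proof (rule plancherel_measureI)
    fix f assume f: "f \<in> L2 \<mu>"
    note [measurable] = borel_measurable_fourier_fun_\<mu>[OF f]
    have "(\<integral>\<^sup>+ t. ennreal ((cmod (fourier_fun \<mu> f t))\<^sup>2) \<partial>density lborel (\<lambda>x. ennreal ((cmod (fourier_measure \<mu>' x))\<^sup>2)))
        = (\<integral>\<^sup>+ t. ennreal ((cmod (fourier_fun unit_lebesgue (\<lambda>x. f (odd_digits x)) t))\<^sup>2) \<partial>lborel)"
      by (subst nn_integral_density) (auto simp: coeff[OF f])
    then show "(\<integral>\<^sup>+ t. ennreal ((cmod (fourier_fun \<mu> f t))\<^sup>2) \<partial>density lborel (\<lambda>x. ennreal ((cmod (fourier_measure \<mu>' x))\<^sup>2)))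
        = ennreal (LINT x|\<mu>. (cmod (f x))\<^sup>2)"
      using plancherel_unit_interval[OF L2_comp_odd_digits(1)[OF f]] L2_comp_odd_digits(2)[OF f] by simp
  qed (auto intro: borel_measurable_fourier_fun_\<mu>)
  moreover have "plancherel_measure
      (sum_measure (\<lambda>n::int. scale_measure (ennreal ((cmod (fourier_measure \<mu>' (of_int n)))\<^sup>2))
                                          (return borel (of_int n)))) \<mu>"
    unfolding sum_measure_scaled_Dirac[OF zero_le_power2]
  proof (rule plancherel_measureI)
    fix f assume f: "f \<in> L2 \<mu>"
    note [measurable] = borel_measurable_fourier_fun_\<mu>[OF f]
    have "(\<integral>\<^sup>+ t. ennreal ((cmod (fourier_fun \<mu> f t))\<^sup>2)
          \<partial>distr (density (count_space UNIV) (\<lambda>n::int. ennreal ((cmod (fourier_measure \<mu>' (of_int n)))\<^sup>2))) borel of_int)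
        = (\<integral>\<^sup>+ (n::int). ennreal ((cmod (fourier_fun unit_lebesgue (\<lambda>x. f (odd_digits x)) (of_int n)))\<^sup>2) \<partial>count_space UNIV)"
      by (subst nn_integral_distr) (auto simp: nn_integral_density coeff[OF f])
    then show "(\<integral>\<^sup>+ t. ennreal ((cmod (fourier_fun \<mu> f t))\<^sup>2)
          \<partial>distr (density (count_space UNIV) (\<lambda>n::int. ennreal ((cmod (fourier_measure \<mu>' (of_int n)))\<^sup>2))) borel of_int)
        = ennreal (LINT x|\<mu>. (cmod (f x))\<^sup>2)"
      using nn_integral_parseval_unit_interval[OF L2_comp_odd_digits(1)[OF f]] L2_comp_odd_digits(2)[OF f] by simp
  qed (auto intro: borel_measurable_fourier_fun_\<mu>)
  moreover have "L2_parseval_frame \<mu>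
      (\<lambda>(n::int) x. complex_of_real (cmod (fourier_measure \<mu>' (of_int n))) * expo (of_int n) x)"
    unfolding L2_parseval_frame_def by (rule L2_frame_transfer[OF L2_frame_unit_expo])
  ultimately show ?thesis
    using L2_frame_transfer by blast
qed

end
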